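(* Assume that the noise $\xi_n=y_nx_n-\mathbb E[y_nx_n]$ has $\mathbb E\|\xi_n\|^2<\infty$ and satisfies $\mathbb E[\xi_n\otimes\xi_n]\preccurlyeq\tau^2\Sigma$ for some $\tau\in\mathbb R$. Let $\lambda\ge0$, let $\gamma>0$ be a constant step-size with $\gamma(\Sigma+\lambda I)\preccurlyeq I$, and let $\delta\in\Big[\frac{1-\sqrt{\gamma\lambda}}{1+\sqrt{\gamma\lambda}},1\Big]$. Let $\theta_0\in\mathcal H$, $\theta_{-1}=\theta_0$, and for $n\ge1$ $$\theta_n=\big[I-\gamma\Sigma-\gamma\lambda I\big]\big[\theta_{n-1}+\delta(\theta_{n-1}-\theta_{n-2})\big]+\gamma\,y_nx_n+\gamma\lambda\,\theta_0,\qquad \bar\theta_n=\frac1{n+1}\sum_{i=0}^n\theta_i .$$ Then for every $n\ge1$ $$\mathbb E f(\bar\theta_n)-f(\theta_* )\le\min_{r\in[0,1],\ b\in[0,1]}\bigg[2\,\big\|\Sigma^{r/2}(\theta_0-\theta_* )\big\|^2\,\lambda^{-r}\Big(\frac{36}{\gamma(n+1)^2}+\lambda\Big)+8\,\frac{\tau^2\operatorname{tr}(\Sigma^b)\,\lambda^{-b}}{n+1}\bigg].$$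
   Context: $\mathcal H$ is a Euclidean space of dimension $d\ge1$. The observations $(x_n,y_n)\in\mathcal H\times\mathbb R$, $n\ge1$, are i.i.d. with $\mathbb E\|x_n\|^2$ and $\mathbb E y_n^2$ finite. The objective is $f(\theta)=\frac12\mathbb E(\langle x_n,\theta\rangle-y_n)^2$. $\Sigma=\mathbb E[x_n\otimes x_n]$ is the covariance matrix, assumed invertible, and $\theta_*=\Sigma^{-1}\mathbb E[y_nx_n]$ is the global minimizer of $f$. $A\preccurlyeq B$ means that $B-A$ is positive semi-definite. When $\lambda=0$, $\lambda^{-a}$ is read as $1$ for $a=0$ and as $+\infty$ for $a>0$ (so such $r$ or $b$ are disregarded in the minimum). $\theta_0$ is deterministic. *)

theory Defs
  imports "HOL-Probability.Probability"
begin

text \<open>Operators on the Euclidean space are plain functions \<open>'a \<Rightarrow> 'a\<close>; with the convention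
  \<open>(u \<otimes> u) v = \<langle>u, v\<rangle> u\<close>, the following is the operator \<open>E[X \<otimes> X]\<close>, with the expectation taken
  pointwise in \<open>v\<close>.\<close>

definition second_moment :: "'w measure \<Rightarrow> ('w \<Rightarrow> 'a::euclidean_space) \<Rightarrow> 'a \<Rightarrow> 'a" where
  "second_moment M X v = (\<integral>\<omega>. (X \<omega> \<bullet> v) *\<^sub>R X \<omega> \<partial>M)"

definition psd_op :: "('a::euclidean_space \<Rightarrow> 'a) \<Rightarrow> bool" where
  "psd_op A \<longleftrightarrow> linear A \<and> (\<forall>u v. A u \<bullet> v = u \<bullet> A v) \<and> (\<forall>v. 0 \<le> A v \<bullet> v)"

definition loewner_le :: "('a::euclidean_space \<Rightarrow> 'a) \<Rightarrow> ('a \<Rightarrow> 'a) \<Rightarrow> bool"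
    (infix \<open>\<preceq>\<^sub>L\<close> 50) where
  "A \<preceq>\<^sub>L B \<longleftrightarrow> psd_op (\<lambda>v. B v - A v)"

definition trace_op :: "('a::euclidean_space \<Rightarrow> 'a) \<Rightarrow> real" where
  "trace_op A = (\<Sum>e\<in>Basis. A e \<bullet> e)"

text \<open>The real power \<open>A\<^sup>s\<close> in the sense of functional calculus: the linear map that multiplies
  each eigenvector of \<open>A\<close> with eigenvalue \<open>\<mu>\<close> by \<open>\<mu>\<^sup>s\<close>. It exists and is unique for self-adjoint
  \<open>A\<close>, whose eigenvectors span the space. It is only meant for positive definite \<open>A\<close>; for \<open>\<mu> > 0\<close>
  one has \<open>\<mu> powr 0 = 1\<close>, so that \<open>A\<^sup>0\<close> is the identity.\<close>

definition op_powr :: "('a::euclidean_space \<Rightarrow> 'a) \<Rightarrow> real \<Rightarrow> 'a \<Rightarrow> 'a" where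
  "op_powr A s =
    (THE T. linear T \<and> (\<forall>v \<mu>. A v = \<mu> *\<^sub>R v \<longrightarrow> T v = (\<mu> powr s) *\<^sub>R v))"

text \<open>\<open>c\<^sup>-\<^sup>a\<close> for \<open>c, a \<ge> 0\<close>, with the convention that \<open>0\<^sup>-\<^sup>0 = 1\<close> and \<open>0\<^sup>-\<^sup>a = \<infinity>\<close> for \<open>a > 0\<close>
  (in contrast to \<open>0 powr a = 0\<close>).\<close>

definition neg_power :: "real \<Rightarrow> real \<Rightarrow> ereal" where
  "neg_power c a = (if c = 0 then (if a = 0 then 1 else \<infinity>) else ereal (c powr (- a)))"

definition lsq_risk :: "'w measure \<Rightarrow> ('w \<Rightarrow> 'a::euclidean_space) \<Rightarrow> ('w \<Rightarrow> real) \<Rightarrow> 'a \<Rightarrow> real" where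
  "lsq_risk M X Y \<theta> = (1 / 2) * (\<integral>\<omega>. (X \<omega> \<bullet> \<theta> - Y \<omega>)\<^sup>2 \<partial>M)"

end

theory Submission
  imports Defs
begin

text \<open>In an orthonormal eigenbasis of \<open>\<Sigma>\<close> the recursion decouples into scalar ones. For the eigenvalue
  \<open>s\<close> put \<open>a = \<gamma> (s + \<lambda>)\<close>; everything is governed by the solution \<open>D\<close> of the noiseless recursion
  \<open>D\<^sub>n = (1 - a) (D\<^sub>n\<^sub>-\<^sub>1 + \<delta> (D\<^sub>n\<^sub>-\<^sub>1 - D\<^sub>n\<^sub>-\<^sub>2))\<close> with \<open>D\<^sub>-\<^sub>1 = D\<^sub>0 = 1\<close>: summing the iterates, the coefficient
  of the \<open>k\<close>-th noise term telescopes to \<open>\<gamma> (1 - D\<^sub>n\<^sub>-\<^sub>k\<^sub>+\<^sub>1) / a\<close>. The energy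
  \<open>a D\<^sub>n\<^sup>2 + (1 - a) (D\<^sub>n - D\<^sub>n\<^sub>-\<^sub>1)\<^sup>2\<close> contracts by \<open>1 - a\<close> in every step, for every \<open>\<bar>\<delta>\<bar> \<le> 1\<close>. Hence
  \<open>\<bar>D\<^sub>n\<bar> \<le> 1\<close>, which bounds the variance, and \<open>\<bar>D\<^sub>n - D\<^sub>n\<^sub>-\<^sub>1\<bar> \<le> \<surd>a\<close>, which together with
  \<open>1 - \<delta> \<le> 2 \<surd>(\<gamma> \<lambda>)\<close> gives \<open>\<surd>a \<bar>D\<^sub>0 + \<dots> + D\<^sub>n\<bar> \<le> 7\<close> and thus the bias. All powers \<open>r\<close> and \<open>b\<close> come
  from the single inequality \<open>s / (s + \<lambda>) \<le> s\<^sup>r \<lambda>\<^sup>-\<^sup>r\<close>.\<close>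

section \<open>Spectral decomposition\<close>

text \<open>The Rayleigh quotient attains its maximum on the compact unit sphere of
  \<open>V\<close>, and vanishing of the first variation at a maximizer is the eigenvector
  equation.\<close>

lemma selfadjoint_has_eigenvector:
  fixes A :: "'a::euclidean_space \<Rightarrow> 'a"
  assumes A: "linear A" "\<And>u v. A u \<bullet> v = u \<bullet> A v"
    and V: "subspace V" "A ` V \<subseteq> V" "V \<noteq> {0}"
  obtains v where "v \<in> V" "norm v = 1" "A v = (A v \<bullet> v) *\<^sub>R v"
proof -
  let ?K = "V \<inter> sphere 0 1"
  obtain w where w: "w \<in> V" "w \<noteq> 0"
    using V subspace_0 by blast
  have "(1 / norm w) *\<^sub>R w \<in> ?K"
    using w V(1) by (auto simp: subspace_scale)
  moreover have "compact ?K"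
    using closed_subspace[OF V(1)] by (simp add: closed_Int_compact)
  moreover have "continuous_on ?K (\<lambda>u. A u \<bullet> u)"
    using A(1) by (intro continuous_intros linear_continuous_on) (simp add: linear_conv_bounded_linear)
  ultimately obtain v where v: "v \<in> ?K" and max: "\<And>u. u \<in> ?K \<Longrightarrow> A u \<bullet> u \<le> A v \<bullet> v"
    using continuous_attains_sup[of ?K "\<lambda>u. A u \<bullet> u"] by blast
  define \<mu> where "\<mu> = A v \<bullet> v"
  have vv: "v \<bullet> v = 1" "v \<in> V"
    using v by (auto simp: norm_eq_1)
  \<comment> \<open>By homogeneity, maximality extends from the sphere to all of \<open>V\<close>:
    this quadratic form is nonnegative there, and it vanishes at \<open>v\<close>.\<close>
  have Q: "0 \<le> \<mu> * (u \<bullet> u) - A u \<bullet> u" if "u \<in> V" for u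
  proof (cases "u = 0")
    case False
    have "(1 / norm u) *\<^sub>R u \<in> ?K"
      using that False V(1) by (auto simp: subspace_scale)
    from max[OF this] have "A u \<bullet> u / (norm u)\<^sup>2 \<le> \<mu>"
      by (simp add: linear_scale[OF A(1)] \<mu>_def power2_eq_square)
    then show ?thesis
      using False by (simp add: field_simps power2_norm_eq_inner)
  qed (simp add: linear_0[OF A(1)])
  \<comment> \<open>The residual of the eigenvector equation serves as the direction of
    perturbation. It lies in \<open>V\<close> by invariance, and along it the form has the linear
    coefficient \<open>2 * (u \<bullet> u)\<close>.\<close>
  define u where "u = \<mu> *\<^sub>R v - A v"
  define c where "c = \<mu> * (u \<bullet> u) - A u \<bullet> u"
  have uV: "u \<in> V"
    using V vv unfolding u_def by (auto intro!: subspace_diff subspace_scale)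
  have "0 \<le> 2 * t * (u \<bullet> u) + t\<^sup>2 * c" for t
  proof -
    have "v + t *\<^sub>R u \<in> V"
      using V(1) uV vv(2) by (intro subspace_add subspace_scale)
    then have "0 \<le> \<mu> * ((v + t *\<^sub>R u) \<bullet> (v + t *\<^sub>R u)) - A (v + t *\<^sub>R u) \<bullet> (v + t *\<^sub>R u)"
      by (rule Q)
    also have "\<dots> = (\<mu> * (v \<bullet> v) - A v \<bullet> v) + 2 * t * (\<mu> * (v \<bullet> u) - A v \<bullet> u) + t\<^sup>2 * c"
      using A(2)[of u v]
      by (simp add: linear_add[OF A(1)] linear_scale[OF A(1)] inner_add_left inner_add_right
          c_def power2_eq_square algebra_simps inner_commute)
    also have "\<mu> * (v \<bullet> u) - A v \<bullet> u = u \<bullet> u"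
      by (simp add: u_def inner_diff_left)
    finally show ?thesis
      by (simp add: \<mu>_def vv)
  qed
  note quad = this
  have "u \<bullet> u = 0"
  proof (rule ccontr)
    assume "u \<bullet> u \<noteq> 0"
    then have pos: "u \<bullet> u > 0"
      by (simp add: order_less_le)
    \<comment> \<open>Negative, and so short that the quadratic term offsets at most half of the
      linear one: \<open>t\<^sup>2 * c \<le> - (t * (u \<bullet> u))\<close>.\<close>
    define t where "t = - (u \<bullet> u) / (\<bar>c\<bar> + 1)"
    have t: "t < 0"
      using pos by (simp add: t_def divide_neg_pos)
    have "t\<^sup>2 * c \<le> t\<^sup>2 * (\<bar>c\<bar> + 1)"
      by (intro mult_left_mono) auto
    also have "\<dots> = - (t * (u \<bullet> u))"
      by (simp add: t_def power2_eq_square add_nonneg_eq_0_iff)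
    finally have "0 \<le> t * (u \<bullet> u)"
      using quad[of t] by simp
    then show False
      using t pos by (simp add: zero_le_mult_iff)
  qed
  then have "A v = \<mu> *\<^sub>R v"
    by (simp add: u_def)
  then show thesis
    using that[of v] v by (simp add: \<mu>_def)
qed

text \<open>Induction on the dimension: one unit eigenvector \<open>v\<close> is split off, and
  self-adjointness makes its orthogonal complement in \<open>V\<close> invariant again.\<close>

lemma selfadjoint_subspace_eigenbasis:
  fixes A :: "'a::euclidean_space \<Rightarrow> 'a"
  assumes A: "linear A" "\<And>u v. A u \<bullet> v = u \<bullet> A v"
    and V: "subspace V" "A ` V \<subseteq> V"
  shows "\<exists>E\<subseteq>V. pairwise orthogonal E \<and> (\<forall>e\<in>E. norm e = 1 \<and> A e = (A e \<bullet> e) *\<^sub>R e) \<and> span E = V"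
  using V
proof (induction "dim V" arbitrary: V rule: less_induct)
  case less
  show ?case
  proof (cases "V = {0}")
    case True
    then show ?thesis by (intro exI[of _ "{}"]) auto
  next
    case False
    obtain v where v: "v \<in> V" "norm v = 1" "A v = (A v \<bullet> v) *\<^sub>R v"
      using selfadjoint_has_eigenvector[OF A less.prems False] by metis
    define W where "W = V \<inter> {u. v \<bullet> u = 0}"
    have W: "subspace W"
      unfolding W_def using less.prems(1) subspace_hyperplane by (metis subspace_inter)
    have "A ` W \<subseteq> W"
    proof
      fix z assume "z \<in> A ` W"
      then obtain u where u: "u \<in> V" "v \<bullet> u = 0" "z = A u"
        by (auto simp: W_def)
      have "v \<bullet> A u = A v \<bullet> u"
        using A(2) by simp
      also have "\<dots> = 0"
        by (subst v(3)) (simp add: u(2))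
      finally show "z \<in> W"
        using u less.prems(2) by (auto simp: W_def)
    qed
    moreover have "dim W < dim V"
    proof (rule dim_psubset)
      have "v \<notin> W"
        using v(2) by (auto simp: W_def norm_eq_1)
      then have "W \<subset> V"
        using v(1) unfolding W_def by blast
      then show "span W \<subset> span V"
        using W less.prems(1) by (metis span_eq_iff)
    qed
    ultimately obtain E where E: "E \<subseteq> W" "pairwise orthogonal E" "span E = W"
      "\<And>e. e \<in> E \<Longrightarrow> norm e = 1 \<and> A e = (A e \<bullet> e) *\<^sub>R e"
      using less.hyps[of W] W by blast
    have "pairwise orthogonal (insert v E)"
      using E(1,2) by (auto simp: pairwise_insert orthogonal_def W_def inner_commute)
    moreover have "span (insert v E) = V"
    proof
      show "span (insert v E) \<subseteq> V"
        using E(1) v(1) less.prems(1) by (intro span_minimal) (auto simp: W_def)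
      show "V \<subseteq> span (insert v E)"
      proof
        fix u assume "u \<in> V"
        then have "u - (u \<bullet> v) *\<^sub>R v \<in> W"
          using v less.prems(1)
          by (auto simp: W_def subspace_diff subspace_scale inner_diff_right inner_commute norm_eq_1)
        then show "u \<in> span (insert v E)"
          using E(3) span_breakdown_eq by blast
      qed
    qed
    ultimately show ?thesis
      using E v by (intro exI[of _ "insert v E"]) (auto simp: W_def)
  qed
qed

text \<open>The \<open>Basis\<close> of the type need not diagonalize \<open>A\<close>, hence the
  separate finite set \<open>E\<close>. Indexing eigenvalues by basis vectors counts them with
  multiplicity.\<close>

locale orthonormal_eigenbasis =
  fixes A :: "'a::euclidean_space \<Rightarrow> 'a" and E :: "'a set" and \<sigma> :: "'a \<Rightarrow> real"
  assumes linear_A: "linear A"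
    and finite_E: "finite E"
    and orthonormal: "\<And>e f. e \<in> E \<Longrightarrow> f \<in> E \<Longrightarrow> e \<bullet> f = (if e = f then 1 else 0)"
    and span_E: "span E = UNIV"
    and eigen: "\<And>e. e \<in> E \<Longrightarrow> A e = \<sigma> e *\<^sub>R e"
begin

lemma expand: "(\<Sum>e\<in>E. (v \<bullet> e) *\<^sub>R e) = v"
proof (rule orthonormal_basis_expand)
  show "pairwise orthogonal E"
    using orthonormal by (auto simp: pairwise_def orthogonal_def)
qed (use orthonormal in \<open>auto simp: finite_E span_E norm_eq_1\<close>)

lemma inner_sum_basis: "e \<in> E \<Longrightarrow> (\<Sum>f\<in>E. c f *\<^sub>R f) \<bullet> e = c e"
  by (simp add: inner_sum_left orthonormal finite_E if_distrib[of "\<lambda>x. c _ * x"] sum.delta cong: if_cong)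

lemma inner_expand: "u \<bullet> v = (\<Sum>e\<in>E. (u \<bullet> e) * (v \<bullet> e))"
  by (subst (1) expand[of v, symmetric]) (simp add: inner_sum_right mult.commute)

lemma apply_expand: "A v = (\<Sum>e\<in>E. (\<sigma> e * (v \<bullet> e)) *\<^sub>R e)"
  by (subst expand[of v, symmetric])
     (simp add: linear_sum[OF linear_A] linear_scale[OF linear_A] eigen mult.commute)

lemma inner_apply: "e \<in> E \<Longrightarrow> A v \<bullet> e = \<sigma> e * (v \<bullet> e)"
  by (simp add: apply_expand inner_sum_basis)

text \<open>Justifies the \<open>THE\<close> in \<open>op_powr\<close>: the diagonal map qualifies,
  and every other candidate agrees with it on the spanning set \<open>E\<close>.\<close>

lemma op_powr_eq: "op_powr A p v = (\<Sum>e\<in>E. (\<sigma> e powr p * (v \<bullet> e)) *\<^sub>R e)"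
proof -
  define T where "T = (\<lambda>v. \<Sum>e\<in>E. (\<sigma> e powr p * (v \<bullet> e)) *\<^sub>R e)"
  have lin: "linear T"
    unfolding T_def
    by (intro linearI) (simp_all add: inner_add_left algebra_simps sum.distrib scaleR_sum_right)
  have eig: "T v = (\<mu> powr p) *\<^sub>R v" if "A v = \<mu> *\<^sub>R v" for v \<mu>
  proof -
    \<comment> \<open>An eigenvector for \<open>\<mu>\<close> has coordinate zero along every
      \<open>e\<close> with \<open>\<sigma> e \<noteq> \<mu>\<close>, so \<open>\<sigma> e\<close>
      may be replaced by \<open>\<mu>\<close> under \<open>powr\<close>.\<close>
    have "\<sigma> e * (v \<bullet> e) = \<mu> * (v \<bullet> e)" if "e \<in> E" for e
      using inner_apply[OF that, of v] unfolding \<open>A v = \<mu> *\<^sub>R v\<close> by auto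
    then have "T v = (\<Sum>e\<in>E. (\<mu> powr p * (v \<bullet> e)) *\<^sub>R e)"
      unfolding T_def by (intro sum.cong refl) auto
    also have "\<dots> = (\<mu> powr p) *\<^sub>R (\<Sum>e\<in>E. (v \<bullet> e) *\<^sub>R e)"
      by (simp add: scaleR_sum_right)
    finally show ?thesis
      by (simp add: expand)
  qed
  have "op_powr A p = T"
    unfolding op_powr_def
  proof (rule the_equality)
    fix T' assume T': "linear T' \<and> (\<forall>v \<mu>. A v = \<mu> *\<^sub>R v \<longrightarrow> T' v = (\<mu> powr p) *\<^sub>R v)"
    show "T' = T"
    proof
      fix v
      show "T' v = T v"
        by (rule linear_eq_on_span[of T' T E]) (use T' lin eig[OF eigen] eigen span_E in auto)
    qed
  qed (use lin eig in blast)
  then show ?thesis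
    by (simp add: T_def)
qed

lemma norm_op_powr: "(norm (op_powr A (r / 2) v))\<^sup>2 = (\<Sum>e\<in>E. \<sigma> e powr r * (v \<bullet> e)\<^sup>2)"
proof -
  have "(norm (op_powr A (r / 2) v))\<^sup>2 = (\<Sum>e\<in>E. (\<sigma> e powr (r / 2) * (v \<bullet> e))\<^sup>2)"
    unfolding power2_norm_eq_inner
    by (subst inner_expand, intro sum.cong)
       (simp_all add: op_powr_eq inner_sum_basis power2_eq_square)
  also have "\<dots> = (\<Sum>e\<in>E. \<sigma> e powr r * (v \<bullet> e)\<^sup>2)"
    by (intro sum.cong) (simp_all add: power_mult_distrib power2_eq_square flip: powr_add)
  finally show ?thesis .
qed

text \<open>Exchanging the sums and applying Parseval in \<open>Basis\<close> to each unit vector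
  \<open>e\<close> moves the trace to the eigenbasis.\<close>

lemma trace_op_powr: "trace_op (op_powr A p) = (\<Sum>e\<in>E. \<sigma> e powr p)"
proof -
  have "trace_op (op_powr A p) = (\<Sum>b\<in>Basis. \<Sum>e\<in>E. \<sigma> e powr p * (b \<bullet> e)\<^sup>2)"
    unfolding trace_op_def op_powr_eq inner_sum_left
    by (simp add: power2_eq_square inner_commute[of _ "_ :: 'a"] mult.assoc)
  also have "\<dots> = (\<Sum>e\<in>E. \<sigma> e powr p * (\<Sum>b\<in>Basis. (b \<bullet> e)\<^sup>2))"
    by (subst sum.swap) (simp add: sum_distrib_left)
  also have "\<dots> = (\<Sum>e\<in>E. \<sigma> e powr p * (e \<bullet> e))"
    by (subst euclidean_inner) (simp add: power2_eq_square inner_commute)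
  also have "\<dots> = (\<Sum>e\<in>E. \<sigma> e powr p)"
    using orthonormal by simp
  finally show ?thesis .
qed

end

lemma selfadjoint_eigenbasis:
  fixes A :: "'a::euclidean_space \<Rightarrow> 'a"
  assumes A: "linear A" "\<And>u v. A u \<bullet> v = u \<bullet> A v"
  obtains E where "orthonormal_eigenbasis A E (\<lambda>e. A e \<bullet> e)"
proof -
  obtain E where E: "pairwise orthogonal E" "span E = UNIV"
    "\<And>e. e \<in> E \<Longrightarrow> norm e = 1 \<and> A e = (A e \<bullet> e) *\<^sub>R e"
    using selfadjoint_subspace_eigenbasis[OF A subspace_UNIV] by auto
  have "finite E"
    using E(1) pairwise_orthogonal_imp_finite by blast
  then have "orthonormal_eigenbasis A E (\<lambda>e. A e \<bullet> e)"
    using A(1) E unfolding orthonormal_eigenbasis_def pairwise_def orthogonal_def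
    by (metis norm_eq_1)
  then show thesis ..
qed

section \<open>The scalar accelerated recursion\<close>

text \<open>The index is shifted by one: the values at \<open>0\<close> and \<open>1\<close> stand for the indices \<open>-1\<close> and \<open>0\<close>.\<close>

fun momentum_seq :: "real \<Rightarrow> real \<Rightarrow> nat \<Rightarrow> real" where
  "momentum_seq p d 0 = 1"
| "momentum_seq p d (Suc 0) = 1"
| "momentum_seq p d (Suc (Suc n)) =
    p * (momentum_seq p d (Suc n) + d * (momentum_seq p d (Suc n) - momentum_seq p d n))"

text \<open>The position \<open>u\<close> and the velocity \<open>w\<close> of a heavy ball with friction: the weights are chosen
  so that the cross term \<open>u * w\<close> cancels after one step.\<close>

lemma energy_step:
  fixes a d u w :: real
  assumes "0 \<le> a" "a \<le> 1" "\<bar>d\<bar> \<le> 1"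
  defines "p \<equiv> 1 - a"
  defines "u' \<equiv> p * (u + d * w)"
  shows "a * u'\<^sup>2 + p * (u' - u)\<^sup>2 \<le> p * (a * u\<^sup>2 + p * w\<^sup>2)"
proof -
  \<comment> \<open>An exact identity thanks to \<open>p = 1 - a\<close>; the only loss is bounding
    \<open>d\<^sup>2\<close> by one afterwards.\<close>
  have "a * u'\<^sup>2 + p * (u' - u)\<^sup>2 = p * (a * u\<^sup>2 + p * (d\<^sup>2 * w\<^sup>2))"
    unfolding u'_def p_def by algebra
  moreover have "d\<^sup>2 * w\<^sup>2 \<le> 1 * w\<^sup>2"
    using assms(3) by (intro mult_right_mono) (auto simp: abs_square_le_1)
  ultimately show ?thesis
    using assms(1,2) by (auto simp: p_def intro!: mult_left_mono add_left_mono)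
qed

text \<open>Iterates \<open>energy_step\<close>. The two equal initial values mean zero initial
  velocity, so the initial energy is exactly \<open>a\<close>.\<close>

lemma momentum_energy:
  fixes a d :: real
  assumes "0 < a" "a \<le> 1" "\<bar>d\<bar> \<le> 1"
  defines "p \<equiv> 1 - a"
  shows "a * (momentum_seq p d (Suc n))\<^sup>2 + p * (momentum_seq p d (Suc n) - momentum_seq p d n)\<^sup>2
    \<le> p ^ n * a"
proof (induction n)
  case (Suc n)
  let ?D = "momentum_seq p d"
  have "a * (?D (Suc (Suc n)))\<^sup>2 + p * (?D (Suc (Suc n)) - ?D (Suc n))\<^sup>2
      \<le> p * (a * (?D (Suc n))\<^sup>2 + p * (?D (Suc n) - ?D n)\<^sup>2)"
    using energy_step[of a d "?D (Suc n)" "?D (Suc n) - ?D n"] assms by simp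
  also have "\<dots> \<le> p * (p ^ n * a)"
    using Suc assms(2) by (intro mult_left_mono) (auto simp: p_def)
  finally show ?case by simp
qed simp

text \<open>Drops the velocity from the energy and divides by \<open>a\<close>.\<close>

lemma abs_momentum_seq_le_1:
  fixes a d :: real
  assumes "0 < a" "a \<le> 1" "\<bar>d\<bar> \<le> 1"
  shows "\<bar>momentum_seq (1 - a) d n\<bar> \<le> 1"
proof (cases n)
  case (Suc m)
  have "a * (momentum_seq (1 - a) d n)\<^sup>2 \<le> (1 - a) ^ m * a"
    using momentum_energy[OF assms, of m] assms
    by (smt (verit) Suc mult_nonneg_nonneg zero_le_power2)
  also have "\<dots> \<le> 1 * a"
    using assms by (intro mult_right_mono power_le_one) auto
  finally show ?thesis
    using assms(1) by (simp add: abs_square_le_1)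
qed simp

lemma abs_momentum_seq_diff_le:
  fixes a d :: real
  assumes "0 < a" "a \<le> 1" "\<bar>d\<bar> \<le> 1"
  shows "\<bar>momentum_seq (1 - a) d (Suc n) - momentum_seq (1 - a) d n\<bar> \<le> sqrt a"
proof (cases n)
  case (Suc m)
  let ?D = "momentum_seq (1 - a) d"
  show ?thesis
  \<comment> \<open>The weight \<open>1 - a\<close> of the velocity vanishes at
    \<open>a = 1\<close>. There the sequence is zero from index two on, and the bound on its values
    suffices.\<close>
  proof (cases "a = 1")
    case True
    have "\<bar>?D n\<bar> \<le> 1"
      using abs_momentum_seq_le_1[OF assms] .
    then show ?thesis
      using True Suc by simp
  next
    case False
    \<comment> \<open>The energy at \<open>n = Suc m\<close> carries \<open>(1 - a) ^ n\<close>; one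
      of these factors cancels against the weight of the velocity.\<close>
    have "(1 - a) * (?D (Suc n) - ?D n)\<^sup>2 \<le> (1 - a) * ((1 - a) ^ m * a)"
      using momentum_energy[OF assms, of n] assms(1)
      by (smt (verit, best) Suc mult.assoc mult_nonneg_nonneg power_Suc zero_le_power2)
    then have "(?D (Suc n) - ?D n)\<^sup>2 \<le> (1 - a) ^ m * a"
      using False assms(2) by simp
    also have "\<dots> \<le> 1 * a"
      using assms by (intro mult_right_mono power_le_one) auto
    finally show ?thesis
      by (intro real_le_rsqrt) simp
  qed
qed (use assms in simp)

text \<open>The recursion reads \<open>D (k + 2) - D (k + 1) = (1 - a) * d * (D (k + 1) - D k) - a *
  D (k + 1)\<close>, which telescopes when summed. The boundary terms are grouped so that each is of
  order \<open>sqrt a\<close> once \<open>1 - d\<close> is.\<close>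

lemma momentum_seq_sum:
  fixes a d :: real
  defines "D \<equiv> momentum_seq (1 - a) d"
  shows "a * (\<Sum>i\<le>n. D (Suc i)) =
    (1 - D (Suc n)) * (1 - (1 - a) * d) + (D (Suc n) - D (Suc (Suc n)))"
  by (induction n) (simp_all add: D_def algebra_simps)

text \<open>The lower bound on \<open>d\<close> says that \<open>1 - d\<close> is of the order of \<open>q\<close>.\<close>

lemma momentum_seq_sum_bound:
  fixes a d q :: real
  assumes a: "0 < a" "a \<le> 1" and q: "0 \<le> q" "q\<^sup>2 \<le> a" and d: "(1 - q) / (1 + q) \<le> d" "d \<le> 1"
  shows "a * (\<Sum>i\<le>n. momentum_seq (1 - a) d (Suc i))\<^sup>2 \<le> 49"
proof -
  let ?D = "momentum_seq (1 - a) d"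
  have q_le: "q \<le> sqrt a"
    using q by (intro real_le_rsqrt)
  have "sqrt a \<le> 1"
    using a by simp
  have "0 \<le> (1 - q) / (1 + q)"
    using q(1) order_trans[OF q_le \<open>sqrt a \<le> 1\<close>] by simp
  then have d01: "0 \<le> d" "\<bar>d\<bar> \<le> 1"
    using d by linarith+
  have "1 - d \<le> 2 * q / (1 + q)"
    using d(1) q(1) by (simp add: field_simps)
  also have "\<dots> \<le> 2 * q"
    using q(1) by (simp add: field_simps)
  finally have "1 - d \<le> 2 * sqrt a"
    using q_le by simp
  moreover have "a * d \<le> sqrt a"
  proof -
    have "a * d \<le> sqrt a * sqrt a"
      using d(2) a(1) mult_left_le[of d a] by simp
    also have "\<dots> \<le> sqrt a"
      using mult_left_le[OF \<open>sqrt a \<le> 1\<close>, of "sqrt a"] a(1) by simp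
    finally show ?thesis .
  qed
  \<comment> \<open>Splits \<open>1 - (1 - a) * d\<close> as \<open>(1 - d) + a * d\<close>, which
    is at most \<open>2 * sqrt a + sqrt a\<close>.\<close>
  ultimately have p: "1 - (1 - a) * d \<le> 3 * sqrt a" "0 \<le> 1 - (1 - a) * d"
    using mult_left_le[OF d(2), of "1 - a"] a d01 by (auto simp: algebra_simps)
  have D: "\<bar>?D (Suc n)\<bar> \<le> 1" "\<bar>?D (Suc (Suc n)) - ?D (Suc n)\<bar> \<le> sqrt a"
    by (rule abs_momentum_seq_le_1[OF a d01(2)] abs_momentum_seq_diff_le[OF a d01(2)])+
  \<comment> \<open>The constant 7 arises as 2 for \<open>1 - ?D (Suc n)\<close>, times
    \<open>3 * sqrt a\<close>, plus one \<open>sqrt a\<close> for the last increment.\<close>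
  have "\<bar>(1 - ?D (Suc n)) * (1 - (1 - a) * d)\<bar> \<le> 2 * (3 * sqrt a)"
    unfolding abs_mult using D(1) p by (intro mult_mono) auto
  then have "\<bar>a * (\<Sum>i\<le>n. ?D (Suc i))\<bar> \<le> 7 * sqrt a"
    unfolding momentum_seq_sum using D(2) by linarith
  then have "(a * (\<Sum>i\<le>n. ?D (Suc i)))\<^sup>2 \<le> (7 * sqrt a)\<^sup>2"
    using abs_le_square_iff by fastforce
  then show ?thesis
    using a(1) by (simp add: power_mult_distrib power2_eq_square mult.left_commute[of a])
qed

text \<open>Superposition: for \<open>a \<noteq> 0\<close> the forcing \<open>c * z 0\<close> has
  the fixed point \<open>c * z 0 / a\<close>, and the deviation from it evolves like
  \<open>D\<close>; each noise term contributes through the impulse response. The factor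
  \<open>a\<close> on the left replaces a division.\<close>

lemma recursion_solution:
  fixes a c d :: real and z w :: "nat \<Rightarrow> real"
  defines "D \<equiv> momentum_seq (1 - a) d"
  assumes init: "z 1 = z 0"
    and step: "\<And>m. z (Suc (Suc m)) =
      (1 - a) * (z (Suc m) + d * (z (Suc m) - z m)) + c * z 0 + w (Suc m)"
  shows "a * z (Suc m) =
    (c + (a - c) * D (Suc m)) * z 0 + (\<Sum>k=1..m. (D (Suc m - k) - D (Suc (Suc m) - k)) * w k)"
proof -
  \<comment> \<open>The recursion has order two, so two consecutive instances are carried through
    the induction.\<close>
  have "a * z (Suc m) =
      (c + (a - c) * D (Suc m)) * z 0 + (\<Sum>k=1..m. (D (Suc m - k) - D (Suc (Suc m) - k)) * w k) \<and>
    a * z (Suc (Suc m)) =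
      (c + (a - c) * D (Suc (Suc m))) * z 0
        + (\<Sum>k=1..Suc m. (D (Suc (Suc m) - k) - D (Suc (Suc (Suc m)) - k)) * w k)"
  proof (induction m)
    case 0
    then show ?case
      unfolding step[of 0] using init by (simp add: D_def algebra_simps)
  next
    case (Suc m)
    \<comment> \<open>The impulse response scaled by \<open>a\<close>: the decrements of
      \<open>D\<close> obey the same linear recursion and start from \<open>a\<close>.\<close>
    define g where "g = (\<lambda>j. D (Suc j) - D (Suc (Suc j)))"
    have g: "g (Suc (Suc j)) = (1 - a) * (g (Suc j) + d * (g (Suc j) - g j))" for j
      by (simp add: g_def D_def algebra_simps)
    have g01: "g 0 = a" "g (Suc 0) = (1 - a) * (1 + d) * a"
      by (simp_all add: g_def D_def algebra_simps)
    have conv: "(\<Sum>k=1..l. (D (Suc l - k) - D (Suc (Suc l) - k)) * w k) = (\<Sum>k=1..l. g (l - k) * w k)"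
      for l
      by (intro sum.cong) (auto simp: g_def Suc_diff_le)
    have s1: "(\<Sum>k=1..Suc m. g (Suc m - k) * w k) = (\<Sum>k=1..m. g (Suc (m - k)) * w k) + a * w (Suc m)"
      by (simp add: g01 Suc_diff_le)
    \<comment> \<open>The two latest noise terms are split off because the recursion for
      \<open>g\<close> reaches two indices back and so covers only \<open>k \<le> m\<close>.\<close>
    have s2: "(\<Sum>k=1..Suc (Suc m). g (Suc (Suc m) - k) * w k) =
        (\<Sum>k=1..m. g (Suc (Suc (m - k))) * w k) + (1 - a) * (1 + d) * a * w (Suc m) + a * w (Suc (Suc m))"
      by (simp add: g01 Suc_diff_le)
    have s3: "(\<Sum>k=1..m. g (Suc (Suc (m - k))) * w k) =
        (1 - a) * ((1 + d) * (\<Sum>k=1..m. g (Suc (m - k)) * w k) - d * (\<Sum>k=1..m. g (m - k) * w k))"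
      by (simp add: g sum_distrib_left algebra_simps flip: sum.distrib sum_subtractf)
    have D3: "D (Suc (Suc (Suc m))) =
        (1 - a) * ((1 + d) * D (Suc (Suc m)) - d * D (Suc m))"
      by (simp add: D_def algebra_simps)
    have "a * z (Suc (Suc (Suc m))) = (1 - a) * ((1 + d) * (a * z (Suc (Suc m))) - d * (a * z (Suc m)))
        + a * c * z 0 + a * w (Suc (Suc m))"
      by (simp add: step[of "Suc m"] algebra_simps)
    also have "\<dots> = (c + (a - c) * D (Suc (Suc (Suc m)))) * z 0
        + (\<Sum>k=1..Suc (Suc m). g (Suc (Suc m) - k) * w k)"
      unfolding Suc[THEN conjunct1] Suc[THEN conjunct2] conv s1 s2 s3 D3
      by (simp add: algebra_simps)
    finally show ?case
      using Suc unfolding conv by simp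
  qed
  then show ?thesis by blast
qed

text \<open>Summing \<open>recursion_solution\<close> over the iterates, the decrements of
  \<open>D\<close> that multiply a fixed \<open>w k\<close> telescope from
  \<open>D 1 = 1\<close>.\<close>

lemma recursion_partial_sums:
  fixes a c d :: real and z w :: "nat \<Rightarrow> real"
  defines "D \<equiv> momentum_seq (1 - a) d"
  assumes init: "z 1 = z 0"
    and step: "\<And>m. z (Suc (Suc m)) =
      (1 - a) * (z (Suc m) + d * (z (Suc m) - z m)) + c * z 0 + w (Suc m)"
  shows "a * (\<Sum>i\<le>n. z (Suc i)) =
    (c * (real n + 1) + (a - c) * (\<Sum>i\<le>n. D (Suc i))) * z 0
      + (\<Sum>k=1..n. (1 - D (Suc (Suc n) - k)) * w k)"
proof (induction n)
  case 0
  then show ?case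
    using init by (simp add: D_def algebra_simps)
next
  case (Suc n)
  have "(\<Sum>k=1..Suc n. (1 - D (Suc (Suc (Suc n)) - k)) * w k)
      = (\<Sum>k=1..Suc n. (1 - D (Suc (Suc n) - k)) * w k)
        + (\<Sum>k=1..Suc n. (D (Suc (Suc n) - k) - D (Suc (Suc (Suc n)) - k)) * w k)"
    by (simp add: algebra_simps flip: sum.distrib)
  \<comment> \<open>The new summand \<open>k = Suc n\<close> has coefficient
    \<open>1 - D 1 = 0\<close>.\<close>
  also have "(\<Sum>k=1..Suc n. (1 - D (Suc (Suc n) - k)) * w k)
      = (\<Sum>k=1..n. (1 - D (Suc (Suc n) - k)) * w k)"
    by (simp add: D_def)
  finally show ?case
    using Suc recursion_solution[where z = z and m = "Suc n", OF init step] unfolding D_def[symmetric]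
    by (simp add: algebra_simps)
qed

text \<open>The multiplier of the initial error is the convex combination
  \<open>(1 - \<rho>) + \<rho> * B\<close> with \<open>\<rho> = s / (s + lam)\<close>. The pull of
  the regularization towards the starting point gives the term \<open>lam\<close>, and the averaged
  noiseless sequence \<open>B\<close> gives the term in
  \<open>1 / (\<gamma> * N\<^sup>2)\<close>.\<close>

lemma averaged_bias_bound:
  fixes \<gamma> s lam d \<phi> :: real and n :: nat
  assumes pos: "0 < \<gamma>" "0 < s" "0 \<le> lam" and step: "\<gamma> * (s + lam) \<le> 1"
    and d: "(1 - sqrt (\<gamma> * lam)) / (1 + sqrt (\<gamma> * lam)) \<le> d" "d \<le> 1"
    and \<phi>: "s / (s + lam) \<le> \<phi>"
  defines "a \<equiv> \<gamma> * (s + lam)" and "N \<equiv> real n + 1"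
  shows "s / 2 * ((\<gamma> * lam * N + \<gamma> * s * (\<Sum>i\<le>n. momentum_seq (1 - a) d (Suc i))) / (a * N))\<^sup>2
    \<le> 2 * \<phi> * (36 / (\<gamma> * N\<^sup>2) + lam)"
proof -
  define h where "h = s + lam"
  define \<rho> where "\<rho> = s / h"
  define B where "B = (\<Sum>i\<le>n. momentum_seq (1 - a) d (Suc i)) / N"
  have h: "h > 0" and N: "N > 0"
    using pos by (auto simp: N_def h_def)
  have \<rho>: "0 < \<rho>" "\<rho> \<le> 1" "s = \<rho> * h" "lam = (1 - \<rho>) * h"
    using pos h by (auto simp: \<rho>_def h_def field_simps)
  \<comment> \<open>Here \<open>q = sqrt (\<gamma> * lam)\<close>, whose square is at most
    \<open>a\<close>.\<close>
  have "a * (\<Sum>i\<le>n. momentum_seq (1 - a) d (Suc i))\<^sup>2 \<le> 49"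
    by (rule momentum_seq_sum_bound[OF _ _ _ _ d]) (use pos step h in \<open>auto simp: a_def\<close>)
  then have B: "h * B\<^sup>2 \<le> 49 / (\<gamma> * N\<^sup>2)"
    using pos(1) N unfolding B_def a_def h_def[symmetric] power_divide
    by (simp add: pos_le_divide_eq mult.commute[of _ \<gamma>] mult.assoc[symmetric])
  have "(\<gamma> * lam * N + \<gamma> * s * (\<Sum>i\<le>n. momentum_seq (1 - a) d (Suc i))) / (a * N)
      = (1 - \<rho>) + \<rho> * B"
    using pos(1) h N unfolding B_def
    by (simp add: a_def[folded h_def] \<rho>(4) add_divide_distrib) (simp add: \<rho>_def)
  then have "s / 2 * ((\<gamma> * lam * N + \<gamma> * s * (\<Sum>i\<le>n. momentum_seq (1 - a) d (Suc i))) / (a * N))\<^sup>2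
      = s / 2 * ((1 - \<rho>) + \<rho> * B)\<^sup>2"
    by simp
  also have "\<dots> \<le> s / 2 * (2 * (1 - \<rho>)\<^sup>2 + 2 * (\<rho> * B)\<^sup>2)"
    using pos(2) sum_squares_bound[of "1 - \<rho>" "\<rho> * B"]
    by (intro mult_left_mono) (auto simp: power2_sum)
  \<comment> \<open>Writing \<open>s = \<rho> * h\<close> and \<open>lam = (1 - \<rho>) * h\<close>
    leaves one factor \<open>\<rho>\<close> outside, to be bounded by \<open>\<phi>\<close>.\<close>
  also have "\<dots> = \<rho> * ((1 - \<rho>) * lam + \<rho>\<^sup>2 * (h * B\<^sup>2))"
    unfolding \<rho>(3,4) by (simp add: power2_eq_square algebra_simps)
  also have "\<dots> \<le> \<rho> * (lam + 49 / (\<gamma> * N\<^sup>2))"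
  proof (intro mult_left_mono add_mono)
    show "(1 - \<rho>) * lam \<le> lam"
      using \<rho>(1,2) pos(3) by (simp add: mult_left_le_one_le)
    have "\<rho>\<^sup>2 * (h * B\<^sup>2) \<le> h * B\<^sup>2"
      using \<rho>(1,2) h by (simp add: mult_left_le_one_le power_le_one)
    then show "\<rho>\<^sup>2 * (h * B\<^sup>2) \<le> 49 / (\<gamma> * N\<^sup>2)"
      using B by linarith
  qed (use \<rho>(1) in simp)
  also have "\<dots> \<le> \<phi> * (2 * (36 / (\<gamma> * N\<^sup>2) + lam))"
  proof (intro mult_mono)
    \<comment> \<open>The constant 36 enters through \<open>49 \<le> 2 * 36\<close>.\<close>
    have "49 / (\<gamma> * N\<^sup>2) \<le> 2 * (36 / (\<gamma> * N\<^sup>2))"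
      using pos by (simp add: divide_right_mono)
    then show "lam + 49 / (\<gamma> * N\<^sup>2) \<le> 2 * (36 / (\<gamma> * N\<^sup>2) + lam)"
      using pos by simp
    show "\<rho> \<le> \<phi>" "0 \<le> \<phi>"
      using \<phi> \<rho>(1) by (auto simp: \<rho>_def h_def)
  qed (use pos in auto)
  finally show ?thesis
    by (simp add: mult.assoc mult.left_commute)
qed

text \<open>Since \<open>\<bar>1 - D\<bar> \<le> 2\<close>, each weight is at most
  \<open>2 / ((s + lam) * N)\<close> in absolute value. The \<open>n\<close> variances then add up
  to order \<open>1 / N\<close>, and
  \<open>(s / (s + lam))\<^sup>2 \<le> s / (s + lam) \<le> \<psi>\<close>.\<close>

lemma averaged_noise_bound:
  fixes \<gamma> s lam d \<psi> \<tau> :: real and v :: "nat \<Rightarrow> real" and n :: nat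
  assumes pos: "0 < \<gamma>" "0 < s" "0 \<le> lam" and step: "\<gamma> * (s + lam) \<le> 1" and d: "\<bar>d\<bar> \<le> 1"
    and \<psi>: "s / (s + lam) \<le> \<psi>"
    and v: "\<And>k. k \<in> {1..n} \<Longrightarrow> 0 \<le> v k \<and> v k \<le> \<tau>\<^sup>2 * s"
  defines "a \<equiv> \<gamma> * (s + lam)" and "N \<equiv> real n + 1"
  shows "s / 2 * (\<Sum>k=1..n. (\<gamma> * (1 - momentum_seq (1 - a) d (Suc (Suc n) - k)) / (a * N))\<^sup>2 * v k)
    \<le> 8 * (\<tau>\<^sup>2 * \<psi> / N)"
proof -
  define h where "h = s + lam"
  have h: "h > 0" and N: "N > 0" "real n \<le> N"
    using pos by (auto simp: N_def h_def)
  have "(\<gamma> * (1 - momentum_seq (1 - a) d j) / (a * N))\<^sup>2 \<le> (2 / (h * N))\<^sup>2" for j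
  proof -
    have "\<bar>momentum_seq (1 - a) d j\<bar> \<le> 1"
      by (rule abs_momentum_seq_le_1) (use pos step d in \<open>auto simp: a_def\<close>)
    then have "\<bar>1 - momentum_seq (1 - a) d j\<bar> / (h * N) \<le> 2 / (h * N)"
      using h N by (intro divide_right_mono) auto
    moreover have "\<gamma> * (1 - momentum_seq (1 - a) d j) / (a * N) = (1 - momentum_seq (1 - a) d j) / (h * N)"
      using pos(1) by (simp add: a_def h_def)
    ultimately have "\<bar>\<gamma> * (1 - momentum_seq (1 - a) d j) / (a * N)\<bar> \<le> \<bar>2 / (h * N)\<bar>"
      using h N by (simp add: abs_divide)
    then show ?thesis
      unfolding abs_le_square_iff .
  qed
  then have "(\<Sum>k=1..n. (\<gamma> * (1 - momentum_seq (1 - a) d (Suc (Suc n) - k)) / (a * N))\<^sup>2 * v k)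
      \<le> (\<Sum>k=1..n. (2 / (h * N))\<^sup>2 * (\<tau>\<^sup>2 * s))"
    using v by (intro sum_mono mult_mono) auto
  then have "s / 2 * (\<Sum>k=1..n. (\<gamma> * (1 - momentum_seq (1 - a) d (Suc (Suc n) - k)) / (a * N))\<^sup>2 * v k)
      \<le> s / 2 * (real n * ((2 / (h * N))\<^sup>2 * (\<tau>\<^sup>2 * s)))"
    using pos(2) by (intro mult_left_mono) auto
  also have "\<dots> = 2 * \<tau>\<^sup>2 * (s / h)\<^sup>2 * (real n / N\<^sup>2)"
    using h N by (simp add: field_simps power2_eq_square)
  also have "\<dots> \<le> 2 * \<tau>\<^sup>2 * \<psi> * (1 / N)"
  proof (intro mult_mono)
    have "s / h * (s / h) \<le> s / h * 1"
      using pos h by (intro mult_left_mono) (auto simp: h_def)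
    then show "(s / h)\<^sup>2 \<le> \<psi>"
      using \<psi> by (simp add: power2_eq_square h_def)
    show "real n / N\<^sup>2 \<le> 1 / N"
      using N by (simp add: field_simps power2_eq_square)
    show "0 \<le> 2 * \<tau>\<^sup>2 * \<psi>"
      using \<psi> pos by (intro mult_nonneg_nonneg) (auto intro: order_trans[OF _ \<psi>])
  qed auto
  also have "\<dots> \<le> 8 * (\<tau>\<^sup>2 * \<psi> / N)"
  proof -
    have "0 \<le> \<tau>\<^sup>2 * \<psi> / N"
      using \<psi> pos N by (intro divide_nonneg_nonneg mult_nonneg_nonneg) (auto intro: order_trans[OF _ \<psi>])
    then have "2 * (\<tau>\<^sup>2 * \<psi> / N) \<le> 8 * (\<tau>\<^sup>2 * \<psi> / N)"
      by (rule mult_right_mono[rotated]) simp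
    then show ?thesis by simp
  qed
  finally show ?thesis .
qed

text \<open>With \<open>t = s / lam\<close> this is
  \<open>t / (1 + t) \<le> min 1 t \<le> t powr r\<close>. For \<open>lam = 0\<close> a real value
  of \<open>neg_power\<close> forces \<open>r = 0\<close>, and both sides are one.\<close>

lemma ratio_le_powr_times:
  assumes "0 < s" "0 \<le> lam" "r \<in> {0..1}" and L: "neg_power lam r = ereal L"
  shows "s / (s + lam) \<le> s powr r * L"
proof (cases "lam = 0")
  case True
  with L have "r = 0 \<and> L = 1"
    by (auto simp: neg_power_def one_ereal_def split: if_splits)
  then show ?thesis
    using True assms(1) by simp
next
  case False
  then have lam: "lam > 0"
    using assms(2) by simp
  have eq: "s powr r * L = (s / lam) powr r"
    using L lam assms(1) by (auto simp: neg_power_def powr_divide powr_minus_divide)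
  show ?thesis
  proof (cases "s \<le> lam")
    case True
    have "s / (s + lam) \<le> (s / lam) powr 1"
      using assms(1) lam by (simp add: frac_le)
    also have "\<dots> \<le> (s / lam) powr r"
      using True assms lam by (intro powr_mono') auto
    finally show ?thesis using eq by simp
  next
    case False
    have "s / (s + lam) \<le> 1"
      using assms by simp
    also have "1 \<le> (s / lam) powr r"
      using False assms lam by (intro ge_one_powr_ge_zero) auto
    finally show ?thesis using eq by simp
  qed
qed

section \<open>Second moments and the least-squares risk\<close>

text \<open>Centring removes the linear term; independence together with centring removes the
  off-diagonal products.\<close>

lemma (in prob_space) expectation_square_indep_sum:
  fixes W :: "'i \<Rightarrow> 'a \<Rightarrow> real"
  assumes indep: "indep_vars (\<lambda>_. borel) W K" and "finite K"
    and sq: "\<And>k. k \<in> K \<Longrightarrow> integrable M (\<lambda>\<omega>. (W k \<omega>)\<^sup>2)"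
    and centred: "\<And>k. k \<in> K \<Longrightarrow> expectation (W k) = 0"
  shows "integrable M (\<lambda>\<omega>. (c + (\<Sum>k\<in>K. b k * W k \<omega>))\<^sup>2)"
    and "expectation (\<lambda>\<omega>. (c + (\<Sum>k\<in>K. b k * W k \<omega>))\<^sup>2)
      = c\<^sup>2 + (\<Sum>k\<in>K. (b k)\<^sup>2 * expectation (\<lambda>\<omega>. (W k \<omega>)\<^sup>2))"
proof -
  have meas: "random_variable borel (W k)" if "k \<in> K" for k
    using indep that by (auto simp: indep_vars_def)
  have int1: "integrable M (W k)" if "k \<in> K" for k
    using square_integrable_imp_integrable[OF meas sq] that by blast
  have prod: "integrable M (\<lambda>\<omega>. W k \<omega> * W l \<omega>)"
    "expectation (\<lambda>\<omega>. W k \<omega> * W l \<omega>) = (if k = l then expectation (\<lambda>\<omega>. (W k \<omega>)\<^sup>2) else 0)"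
    if kl: "k \<in> K" "l \<in> K" for k l
  proof -
    have "integrable M (\<lambda>\<omega>. W k \<omega> * W l \<omega>) \<and> expectation (\<lambda>\<omega>. W k \<omega> * W l \<omega>) = 0" if "k \<noteq> l"
    proof -
      have "indep_vars (\<lambda>_. borel) W {k, l}"
        using indep by (rule indep_vars_subset) (use kl in auto)
      from indep_vars_lebesgue_integral[OF _ this] indep_vars_integrable[OF _ this]
      show ?thesis
        using int1 kl that centred by auto
    qed
    then show "integrable M (\<lambda>\<omega>. W k \<omega> * W l \<omega>)"
      "expectation (\<lambda>\<omega>. W k \<omega> * W l \<omega>) = (if k = l then expectation (\<lambda>\<omega>. (W k \<omega>)\<^sup>2) else 0)"
      using sq[OF kl(1)] by (auto simp: power2_eq_square)
  qed
  have expand: "(c + (\<Sum>k\<in>K. b k * W k \<omega>))\<^sup>2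
      = c\<^sup>2 + (\<Sum>k\<in>K. 2 * c * b k * W k \<omega>) + (\<Sum>k\<in>K. \<Sum>l\<in>K. b k * b l * (W k \<omega> * W l \<omega>))" for \<omega>
  proof -
    have "(\<Sum>k\<in>K. b k * W k \<omega>)\<^sup>2 = (\<Sum>k\<in>K. \<Sum>l\<in>K. b k * b l * (W k \<omega> * W l \<omega>))"
      by (simp add: power2_eq_square sum_product algebra_simps)
    then show ?thesis
      by (simp add: power2_sum sum_distrib_left mult.assoc)
  qed
  show "integrable M (\<lambda>\<omega>. (c + (\<Sum>k\<in>K. b k * W k \<omega>))\<^sup>2)"
    unfolding expand
    by (intro Bochner_Integration.integrable_add Bochner_Integration.integrable_sum
        integrable_mult_right prod int1) auto
  have "expectation (\<lambda>\<omega>. (c + (\<Sum>k\<in>K. b k * W k \<omega>))\<^sup>2)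
      = c\<^sup>2 + (\<Sum>k\<in>K. 2 * c * b k * expectation (W k))
        + (\<Sum>k\<in>K. \<Sum>l\<in>K. b k * b l * expectation (\<lambda>\<omega>. W k \<omega> * W l \<omega>))"
    unfolding expand using prod(1) int1
    by (simp add: prob_space)
  also have "(\<Sum>k\<in>K. \<Sum>l\<in>K. b k * b l * expectation (\<lambda>\<omega>. W k \<omega> * W l \<omega>))
      = (\<Sum>k\<in>K. \<Sum>l\<in>K. if k = l then (b k)\<^sup>2 * expectation (\<lambda>\<omega>. (W k \<omega>)\<^sup>2) else 0)"
    by (intro sum.cong refl) (simp add: prod(2) power2_eq_square[of "b _"])
  also have "\<dots> = (\<Sum>k\<in>K. (b k)\<^sup>2 * expectation (\<lambda>\<omega>. (W k \<omega>)\<^sup>2))"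
    using \<open>finite K\<close> by simp
  finally show "expectation (\<lambda>\<omega>. (c + (\<Sum>k\<in>K. b k * W k \<omega>))\<^sup>2)
      = c\<^sup>2 + (\<Sum>k\<in>K. (b k)\<^sup>2 * expectation (\<lambda>\<omega>. (W k \<omega>)\<^sup>2))"
    using centred by simp
qed

lemma integrable_mult_square:
  fixes f g :: "'a \<Rightarrow> real"
  assumes [measurable]: "f \<in> borel_measurable M" "g \<in> borel_measurable M"
    and "integrable M (\<lambda>x. (f x)\<^sup>2)" "integrable M (\<lambda>x. (g x)\<^sup>2)"
  shows "integrable M (\<lambda>x. f x * g x)"
proof (rule Bochner_Integration.integrable_bound)
  show "integrable M (\<lambda>x. (f x)\<^sup>2 + (g x)\<^sup>2)"
    using assms by simp
  show "AE x in M. norm (f x * g x) \<le> norm ((f x)\<^sup>2 + (g x)\<^sup>2)"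
  proof (rule AE_I2)
    fix x
    have "2 * \<bar>f x\<bar> * \<bar>g x\<bar> \<le> (f x)\<^sup>2 + (g x)\<^sup>2"
      using sum_squares_bound[of "\<bar>f x\<bar>" "\<bar>g x\<bar>"] by simp
    moreover have "0 \<le> \<bar>f x\<bar> * \<bar>g x\<bar>"
      by simp
    ultimately show "norm (f x * g x) \<le> norm ((f x)\<^sup>2 + (g x)\<^sup>2)"
      unfolding real_norm_def abs_mult by linarith
  qed
qed simp

lemma integrable_square_inner:
  fixes X :: "'w \<Rightarrow> 'a::euclidean_space"
  assumes [measurable]: "X \<in> borel_measurable M" and "integrable M (\<lambda>\<omega>. (norm (X \<omega>))\<^sup>2)"
  shows "integrable M (\<lambda>\<omega>. (X \<omega> \<bullet> u)\<^sup>2)"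
proof (rule Bochner_Integration.integrable_bound)
  show "integrable M (\<lambda>\<omega>. (norm (X \<omega>))\<^sup>2 * (norm u)\<^sup>2)"
    using assms by simp
  show "AE \<omega> in M. norm ((X \<omega> \<bullet> u)\<^sup>2) \<le> norm ((norm (X \<omega>))\<^sup>2 * (norm u)\<^sup>2)"
  proof (rule AE_I2)
    fix \<omega>
    have "\<bar>X \<omega> \<bullet> u\<bar>\<^sup>2 \<le> (norm (X \<omega>) * norm u)\<^sup>2"
      by (intro power_mono Cauchy_Schwarz_ineq2) auto
    then show "norm ((X \<omega> \<bullet> u)\<^sup>2) \<le> norm ((norm (X \<omega>))\<^sup>2 * (norm u)\<^sup>2)"
      by (simp add: power_mult_distrib)
  qed
qed simp

lemma integrable_scaleR_square:
  fixes X :: "'w \<Rightarrow> 'a::euclidean_space" and Y :: "'w \<Rightarrow> real"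
  assumes [measurable]: "X \<in> borel_measurable M" "Y \<in> borel_measurable M"
    and "integrable M (\<lambda>\<omega>. (norm (X \<omega>))\<^sup>2)" "integrable M (\<lambda>\<omega>. (Y \<omega>)\<^sup>2)"
  shows "integrable M (\<lambda>\<omega>. Y \<omega> *\<^sub>R X \<omega>)"
proof (rule Bochner_Integration.integrable_bound)
  show "integrable M (\<lambda>\<omega>. Y \<omega> * norm (X \<omega>))"
    by (rule integrable_mult_square) (use assms in simp_all)
qed simp_all

context
  fixes M :: "'w measure" and X :: "'w \<Rightarrow> 'a::euclidean_space"
  assumes meas_X: "X \<in> borel_measurable M" and sq_X: "integrable M (\<lambda>\<omega>. (norm (X \<omega>))\<^sup>2)"
begin

lemma integrable_second_moment: "integrable M (\<lambda>\<omega>. (X \<omega> \<bullet> v) *\<^sub>R X \<omega>)"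
proof (rule integrable_scaleR_square[OF meas_X _ sq_X])
  show "(\<lambda>\<omega>. X \<omega> \<bullet> v) \<in> borel_measurable M"
    using meas_X by measurable
qed (rule integrable_square_inner[OF meas_X sq_X])

text \<open>Pairing with \<open>u\<close> turns the vector integral into a scalar one, from which
  self-adjointness and positivity can be read off.\<close>

lemma second_moment_inner: "second_moment M X v \<bullet> u = (\<integral>\<omega>. (X \<omega> \<bullet> v) * (X \<omega> \<bullet> u) \<partial>M)"
  unfolding second_moment_def
  by (subst integral_inner_left[symmetric]) (simp_all add: integrable_second_moment)

lemma linear_second_moment: "linear (second_moment M X)"
proof (rule linearI)
  show "second_moment M X (u + v) = second_moment M X u + second_moment M X v" for u v
    unfolding second_moment_def
    by (simp add: inner_add_right scaleR_add_left integrable_second_moment)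
  have "second_moment M X (c *\<^sub>R v) = (\<integral>\<omega>. c *\<^sub>R ((X \<omega> \<bullet> v) *\<^sub>R X \<omega>) \<partial>M)" for c v
    by (simp add: second_moment_def)
  then show "second_moment M X (c *\<^sub>R v) = c *\<^sub>R second_moment M X v" for c v
    by (simp only: integral_scaleR_right second_moment_def)
qed

lemma second_moment_selfadjoint: "second_moment M X u \<bullet> v = u \<bullet> second_moment M X v"
  unfolding inner_commute[of u] second_moment_inner by (simp only: mult.commute)

lemma second_moment_nonneg: "0 \<le> second_moment M X v \<bullet> v"
  unfolding second_moment_inner by simp

text \<open>Completing the square: the risk is quadratic with Hessian
  \<open>second_moment M X\<close>, and the normal equation \<open>opt\<close> expresses its linear
  term through \<open>\<theta>s\<close>.\<close>

lemma excess_risk_eq: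
  assumes Y: "Y \<in> borel_measurable M" "integrable M (\<lambda>\<omega>. (Y \<omega>)\<^sup>2)"
    and opt: "second_moment M X \<theta>s = (\<integral>\<omega>. Y \<omega> *\<^sub>R X \<omega> \<partial>M)"
  shows "lsq_risk M X Y \<theta> - lsq_risk M X Y \<theta>s
    = 1 / 2 * (second_moment M X (\<theta> - \<theta>s) \<bullet> (\<theta> - \<theta>s))"
proof -
  let ?S = "second_moment M X"
  have YX: "integrable M (\<lambda>\<omega>. Y \<omega> *\<^sub>R X \<omega>)"
    using integrable_scaleR_square[OF meas_X Y(1) sq_X Y(2)] .
  have YXu: "integrable M (\<lambda>\<omega>. Y \<omega> * (X \<omega> \<bullet> u))" for u
    using integrable_inner_left[of u M, OF YX] by simp
  have XX: "integrable M (\<lambda>\<omega>. (X \<omega> \<bullet> u) * (X \<omega> \<bullet> u))" for u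
    using integrable_square_inner[OF meas_X sq_X, of u] by (simp add: power2_eq_square)
  have risk: "lsq_risk M X Y u = 1 / 2 * (?S u \<bullet> u - 2 * (?S \<theta>s \<bullet> u) + (\<integral>\<omega>. (Y \<omega>)\<^sup>2 \<partial>M))" for u
  proof -
    have "(\<integral>\<omega>. (X \<omega> \<bullet> u - Y \<omega>)\<^sup>2 \<partial>M)
        = (\<integral>\<omega>. (X \<omega> \<bullet> u) * (X \<omega> \<bullet> u) - 2 * (Y \<omega> * (X \<omega> \<bullet> u)) + (Y \<omega>)\<^sup>2 \<partial>M)"
      by (simp add: power2_diff power2_eq_square algebra_simps)
    also have "\<dots> = ?S u \<bullet> u - 2 * (\<integral>\<omega>. Y \<omega> * (X \<omega> \<bullet> u) \<partial>M) + (\<integral>\<omega>. (Y \<omega>)\<^sup>2 \<partial>M)"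
      using XX[of u] YXu[of u] Y(2) by (simp add: second_moment_inner)
    also have "(\<integral>\<omega>. Y \<omega> * (X \<omega> \<bullet> u) \<partial>M) = ?S \<theta>s \<bullet> u"
      unfolding opt by (subst integral_inner_left[symmetric]) (simp_all add: YX)
    finally show ?thesis
      by (simp add: lsq_risk_def)
  qed
  have "?S (\<theta> - \<theta>s) \<bullet> (\<theta> - \<theta>s) = ?S \<theta> \<bullet> \<theta> - 2 * (?S \<theta>s \<bullet> \<theta>) + ?S \<theta>s \<bullet> \<theta>s"
    using second_moment_selfadjoint[of \<theta> \<theta>s]
    by (simp add: linear_diff[OF linear_second_moment] inner_diff_left inner_diff_right inner_commute)
  then show ?thesis
    by (simp add: risk[of \<theta>] risk[of \<theta>s] algebra_simps)
qed

end

text \<open>Bias plus variance for a single eigenvalue \<open>s\<close>. The bounds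
  \<open>\<phi>\<close> and \<open>\<psi>\<close> stay abstract, so that the exponents
  \<open>r\<close> and \<open>b\<close> enter only by instantiation.\<close>

lemma (in prob_space) averaged_coordinate_bound:
  fixes z w :: "nat \<Rightarrow> 'a \<Rightarrow> real" and n :: nat
  assumes pos: "0 < \<gamma>" "0 < s" "0 \<le> lam" and step: "\<gamma> * (s + lam) \<le> 1"
    and d: "(1 - sqrt (\<gamma> * lam)) / (1 + sqrt (\<gamma> * lam)) \<le> d" "d \<le> 1"
    and \<phi>: "s / (s + lam) \<le> \<phi>" and \<psi>: "s / (s + lam) \<le> \<psi>"
    and indep: "indep_vars (\<lambda>_. borel) w {1..}"
    and sq: "\<And>k. k \<ge> 1 \<Longrightarrow> integrable M (\<lambda>\<omega>. (w k \<omega>)\<^sup>2)"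
    and centred: "\<And>k. k \<ge> 1 \<Longrightarrow> expectation (w k) = 0"
    and var: "\<And>k. k \<ge> 1 \<Longrightarrow> expectation (\<lambda>\<omega>. (w k \<omega>)\<^sup>2) \<le> \<tau>\<^sup>2 * s"
    and init: "\<And>\<omega>. \<omega> \<in> space M \<Longrightarrow> z 0 \<omega> = z0" "\<And>\<omega>. \<omega> \<in> space M \<Longrightarrow> z 1 \<omega> = z0"
    and rec: "\<And>m \<omega>. \<omega> \<in> space M \<Longrightarrow> z (Suc (Suc m)) \<omega> =
      (1 - \<gamma> * (s + lam)) * (z (Suc m) \<omega> + d * (z (Suc m) \<omega> - z m \<omega>))
        + \<gamma> * lam * z0 + \<gamma> * w (Suc m) \<omega>"
  defines "avg \<equiv> \<lambda>\<omega>. (\<Sum>i\<le>n. z (Suc i) \<omega>) / (real n + 1)"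
  shows "integrable M (\<lambda>\<omega>. (avg \<omega>)\<^sup>2)"
    and "s / 2 * expectation (\<lambda>\<omega>. (avg \<omega>)\<^sup>2)
      \<le> 2 * \<phi> * (36 / (\<gamma> * (real n + 1)\<^sup>2) + lam) * z0\<^sup>2 + 8 * (\<tau>\<^sup>2 * \<psi> / (real n + 1))"
proof -
  define a where "a = \<gamma> * (s + lam)"
  define N where "N = real n + 1"
  have a: "a > 0" and N: "N > 0"
    using pos by (auto simp: a_def N_def)
  \<comment> \<open>\<open>A\<close> and \<open>b\<close> are the coefficients of the initial error
    and of the noise in the average, read off \<open>recursion_partial_sums\<close> with
    \<open>c = \<gamma> * lam\<close> and noise \<open>\<gamma> * w k\<close>.\<close>
  define A where "A = (\<gamma> * lam * N + \<gamma> * s * (\<Sum>i\<le>n. momentum_seq (1 - a) d (Suc i))) / (a * N)"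
  define b where "b = (\<lambda>k. \<gamma> * (1 - momentum_seq (1 - a) d (Suc (Suc n) - k)) / (a * N))"
  have avg: "avg \<omega> = A * z0 + (\<Sum>k=1..n. b k * w k \<omega>)" if \<omega>: "\<omega> \<in> space M" for \<omega>
  proof -
    have "a * (\<Sum>i\<le>n. z (Suc i) \<omega>) =
        (\<gamma> * lam * (real n + 1) + (a - \<gamma> * lam) * (\<Sum>i\<le>n. momentum_seq (1 - a) d (Suc i))) * z 0 \<omega>
        + (\<Sum>k=1..n. (1 - momentum_seq (1 - a) d (Suc (Suc n) - k)) * (\<gamma> * w k \<omega>))"
      by (rule recursion_partial_sums) (use init[OF \<omega>] rec[OF \<omega>] in \<open>auto simp: a_def\<close>)
    also have "a - \<gamma> * lam = \<gamma> * s"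
      by (simp add: a_def algebra_simps)
    also have "\<gamma> * lam * (real n + 1) + \<gamma> * s * (\<Sum>i\<le>n. momentum_seq (1 - a) d (Suc i)) = A * (a * N)"
      using a N by (simp add: A_def N_def)
    finally have "a * (\<Sum>i\<le>n. z (Suc i) \<omega>) / (a * N) = (A * (a * N) * z0
        + (\<Sum>k=1..n. (1 - momentum_seq (1 - a) d (Suc (Suc n) - k)) * (\<gamma> * w k \<omega>))) / (a * N)"
      by (simp add: init[OF \<omega>])
    also have "\<dots> = A * z0 + (\<Sum>k=1..n. b k * w k \<omega>)"
      using a N by (simp add: add_divide_distrib b_def sum_divide_distrib mult_ac)
    finally show ?thesis
      using a by (simp add: avg_def N_def)
  qed
  have indep': "indep_vars (\<lambda>_. borel) w {1..n}"
    using indep by (rule indep_vars_subset) auto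
  note E = expectation_square_indep_sum[OF indep', where c = "A * z0" and b = b]
  have "integrable M (\<lambda>\<omega>. (A * z0 + (\<Sum>k=1..n. b k * w k \<omega>))\<^sup>2)"
    by (rule E(1)) (use sq centred in auto)
  then show "integrable M (\<lambda>\<omega>. (avg \<omega>)\<^sup>2)"
    by (subst Bochner_Integration.integrable_cong[OF refl]) (auto simp: avg)
  have "expectation (\<lambda>\<omega>. (avg \<omega>)\<^sup>2) = expectation (\<lambda>\<omega>. (A * z0 + (\<Sum>k=1..n. b k * w k \<omega>))\<^sup>2)"
    by (intro Bochner_Integration.integral_cong) (auto simp: avg)
  also have "\<dots> = (A * z0)\<^sup>2 + (\<Sum>k=1..n. (b k)\<^sup>2 * expectation (\<lambda>\<omega>. (w k \<omega>)\<^sup>2))"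
    by (rule E(2)) (use sq centred in auto)
  finally have "s / 2 * expectation (\<lambda>\<omega>. (avg \<omega>)\<^sup>2) =
      s / 2 * A\<^sup>2 * z0\<^sup>2 + s / 2 * (\<Sum>k=1..n. (b k)\<^sup>2 * expectation (\<lambda>\<omega>. (w k \<omega>)\<^sup>2))"
    by (simp add: distrib_left power_mult_distrib)
  also have "s / 2 * A\<^sup>2 \<le> 2 * \<phi> * (36 / (\<gamma> * N\<^sup>2) + lam)"
    unfolding A_def a_def N_def by (rule averaged_bias_bound) fact+
  also have "s / 2 * (\<Sum>k=1..n. (b k)\<^sup>2 * expectation (\<lambda>\<omega>. (w k \<omega>)\<^sup>2)) \<le> 8 * (\<tau>\<^sup>2 * \<psi> / N)"
  proof -
    \<comment> \<open>The step-size condition gives \<open>\<gamma> * lam \<le> 1\<close>; hence the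
      lower bound on \<open>d\<close> is nonnegative and the energy estimates apply.\<close>
    have "sqrt (\<gamma> * lam) \<le> 1"
      using pos step by (simp add: distrib_left) (smt (verit) mult_nonneg_nonneg)
    then have "0 \<le> (1 - sqrt (\<gamma> * lam)) / (1 + sqrt (\<gamma> * lam))"
      using pos by simp
    then have "\<bar>d\<bar> \<le> 1"
      using d by linarith
    then show ?thesis
      unfolding b_def a_def N_def using var by (intro averaged_noise_bound) (use assms in auto)
  qed
  finally show "s / 2 * expectation (\<lambda>\<omega>. (avg \<omega>)\<^sup>2)
      \<le> 2 * \<phi> * (36 / (\<gamma> * (real n + 1)\<^sup>2) + lam) * z0\<^sup>2 + 8 * (\<tau>\<^sup>2 * \<psi> / (real n + 1))"
    by (simp add: N_def mult_right_mono)
qed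

section \<open>The convergence bound\<close>

text \<open>A positive exponent makes \<open>neg_power 0 r\<close> infinite, but
  \<open>0 * \<infinity> = 0\<close> in \<open>ereal\<close>. When \<open>c r\<close> vanishes, the
  second assumption therefore has to make the left side zero as well.\<close>

lemma times_neg_power_0_min:
  assumes "0 \<le> c r" "c r = 0 \<Longrightarrow> c 0 = 0"
  shows "ereal (c 0) * neg_power 0 0 \<le> ereal (c r) * neg_power 0 r"
  using assms by (cases "c r = 0") (auto simp: neg_power_def)

text \<open>The bound takes values in \<open>ereal\<close> because \<open>neg_power\<close> may be
  infinite, and the minimum is stated as attained rather than as an infimum. The \<open>int\<close>
  index accommodates \<open>\<theta> (- 1)\<close>.\<close>

theorem theorem3:
  fixes M :: "'w measure"
    and x \<xi> :: "nat \<Rightarrow> 'w \<Rightarrow> 'a::euclidean_space"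
    and y :: "nat \<Rightarrow> 'w \<Rightarrow> real"
    and S :: "'a \<Rightarrow> 'a"
    and \<theta> :: "int \<Rightarrow> 'w \<Rightarrow> 'a"
    and \<theta>bar :: "nat \<Rightarrow> 'w \<Rightarrow> 'a"
    and \<theta>0 \<theta>star :: 'a
    and \<tau> lam \<gamma> \<delta> :: real
    and n :: nat
  assumes "prob_space M"
    and indep: "prob_space.indep_vars M (\<lambda>_. borel) (\<lambda>k \<omega>. (x k \<omega>, y k \<omega>)) {1..}"
    and ident: "\<And>k. k \<ge> 1 \<Longrightarrow>
      distr M borel (\<lambda>\<omega>. (x k \<omega>, y k \<omega>)) = distr M borel (\<lambda>\<omega>. (x 1 \<omega>, y 1 \<omega>))"
    and x_sq: "\<And>k. k \<ge> 1 \<Longrightarrow> integrable M (\<lambda>\<omega>. (norm (x k \<omega>))\<^sup>2)"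
    and y_sq: "\<And>k. k \<ge> 1 \<Longrightarrow> integrable M (\<lambda>\<omega>. (y k \<omega>)\<^sup>2)"
    and S: "S = second_moment M (x 1)"
    and S_inv: "bij S"
    and \<theta>star: "\<theta>star = inv S (\<integral>\<omega>. y 1 \<omega> *\<^sub>R x 1 \<omega> \<partial>M)"
    and \<xi>: "\<And>k \<omega>. k \<ge> 1 \<Longrightarrow> \<omega> \<in> space M \<Longrightarrow>
      \<xi> k \<omega> = y k \<omega> *\<^sub>R x k \<omega> - (\<integral>\<omega>'. y k \<omega>' *\<^sub>R x k \<omega>' \<partial>M)"
    and \<xi>_sq: "\<And>k. k \<ge> 1 \<Longrightarrow> integrable M (\<lambda>\<omega>. (norm (\<xi> k \<omega>))\<^sup>2)"
    and \<xi>_cov: "\<And>k. k \<ge> 1 \<Longrightarrow> second_moment M (\<xi> k) \<preceq>\<^sub>L (\<lambda>v. \<tau>\<^sup>2 *\<^sub>R S v)"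
    and lam: "lam \<ge> 0"
    and \<gamma>: "\<gamma> > 0"
    and step: "(\<lambda>v. \<gamma> *\<^sub>R (S v + lam *\<^sub>R v)) \<preceq>\<^sub>L (\<lambda>v. v)"
    and \<delta>: "\<delta> \<in> {(1 - sqrt (\<gamma> * lam)) / (1 + sqrt (\<gamma> * lam)) .. 1}"
    and \<theta>_init: "\<And>\<omega>. \<omega> \<in> space M \<Longrightarrow> \<theta> 0 \<omega> = \<theta>0"
                "\<And>\<omega>. \<omega> \<in> space M \<Longrightarrow> \<theta> (- 1) \<omega> = \<theta> 0 \<omega>"
    and \<theta>_step: "\<And>k \<omega>. k \<ge> 1 \<Longrightarrow> \<omega> \<in> space M \<Longrightarrow>
      \<theta> (int k) \<omega> =
        (\<lambda>v. v - \<gamma> *\<^sub>R S v - (\<gamma> * lam) *\<^sub>R v)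
          (\<theta> (int k - 1) \<omega> + \<delta> *\<^sub>R (\<theta> (int k - 1) \<omega> - \<theta> (int k - 2) \<omega>))
        + (\<gamma> * y k \<omega>) *\<^sub>R x k \<omega> + (\<gamma> * lam) *\<^sub>R \<theta>0"
    and \<theta>bar: "\<And>k \<omega>. \<omega> \<in> space M \<Longrightarrow>
      \<theta>bar k \<omega> = (1 / (real k + 1)) *\<^sub>R (\<Sum>i=0..k. \<theta> (int i) \<omega>)"
    and n: "n \<ge> 1"
  shows "let B = (\<lambda>r b.
        2 * ereal ((norm (op_powr S (r / 2) (\<theta>0 - \<theta>star)))\<^sup>2) * neg_power lam r
          * ereal (36 / (\<gamma> * (real n + 1)\<^sup>2) + lam)
        + 8 * (ereal (\<tau>\<^sup>2 * trace_op (op_powr S b)) * neg_power lam b / ereal (real n + 1)))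
    in \<exists>r\<in>{0..1}. \<exists>b\<in>{0..1}.
        (\<forall>r'\<in>{0..1}. \<forall>b'\<in>{0..1}. B r b \<le> B r' b') \<and>
        ereal ((\<integral>\<omega>. lsq_risk M (x 1) (y 1) (\<theta>bar n \<omega>) \<partial>M) - lsq_risk M (x 1) (y 1) \<theta>star)
          \<le> B r b"
proof -
  interpret prob_space M by fact

  \<comment> \<open>Measurability, the common mean and the normal equation\<close>
  define m where "m = (\<integral>\<omega>. y 1 \<omega> *\<^sub>R x 1 \<omega> \<partial>M)"
  have pair[measurable]: "random_variable borel (\<lambda>\<omega>. (x k \<omega>, y k \<omega>))" if "k \<ge> 1" for k
    using indep that by (auto simp: indep_vars_def)
  have [measurable]: "random_variable borel (x k)" "random_variable borel (y k)" if "k \<ge> 1" for k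
    using measurable_compose[OF pair[OF that], of fst borel]
      measurable_compose[OF pair[OF that], of snd borel]
    by (simp_all add: borel_measurable_continuous_onI continuous_on_fst continuous_on_snd continuous_on_id)
  note meas = this
  have yx: "integrable M (\<lambda>\<omega>. y k \<omega> *\<^sub>R x k \<omega>)" if "k \<ge> 1" for k
    using integrable_scaleR_square[OF meas(1)[OF that] meas(2)[OF that] x_sq[OF that] y_sq[OF that]] .
  have mean: "(\<integral>\<omega>. y k \<omega> *\<^sub>R x k \<omega> \<partial>M) = m" if k: "k \<ge> 1" for k
  proof -
    have g: "(\<lambda>p. snd p *\<^sub>R fst p) \<in> borel_measurable (borel :: ('a \<times> real) measure)"
      by (intro borel_measurable_continuous_onI continuous_intros)
    show ?thesis
      using integral_distr[OF pair[OF k] g] integral_distr[OF pair[of 1] g] ident[OF k]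
      by (simp add: m_def)
  qed
  note SM = meas(1)[OF order_refl] x_sq[OF order_refl]
  have lin: "linear S" and self: "\<And>u v. S u \<bullet> v = u \<bullet> S v" and nonneg: "\<And>v. 0 \<le> S v \<bullet> v"
    unfolding S using linear_second_moment[OF SM] second_moment_selfadjoint[OF SM]
      second_moment_nonneg[OF SM] by auto
  have S_opt: "S \<theta>star = m"
    using S_inv by (simp add: \<theta>star m_def bij_is_surj surj_f_inv_f)

  \<comment> \<open>The eigenbasis of the covariance\<close>
  obtain E where "orthonormal_eigenbasis S E (\<lambda>e. S e \<bullet> e)"
    using selfadjoint_eigenbasis[OF lin self] by blast
  moreover define \<sigma> where "\<sigma> = (\<lambda>e. S e \<bullet> e)"
  ultimately interpret eb: orthonormal_eigenbasis S E \<sigma>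
    by simp
  \<comment> \<open>Invertibility excludes the eigenvalue zero, and positive semi-definiteness fixes
    the sign.\<close>
  have pos: "\<sigma> e > 0" if e: "e \<in> E" for e
  proof -
    have "e \<noteq> 0"
      using eb.orthonormal[OF e e] by auto
    then have "S e \<noteq> 0"
      using S_inv linear_0[OF lin] by (metis bij_is_inj injD)
    then have "\<sigma> e \<noteq> 0"
      using eb.eigen[OF e] by auto
    then show ?thesis
      using nonneg[of e] by (simp add: \<sigma>_def)
  qed
  have step_e: "\<gamma> * (\<sigma> e + lam) \<le> 1" if e: "e \<in> E" for e
  proof -
    have "0 \<le> (e - \<gamma> *\<^sub>R (S e + lam *\<^sub>R e)) \<bullet> e"
      using step unfolding loewner_le_def psd_op_def by blast
    then show ?thesis
      using eb.orthonormal[OF e e] by (simp add: \<sigma>_def inner_diff_left inner_add_left)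
  qed

  \<comment> \<open>The noise in eigencoordinates\<close>
  define \<zeta> where "\<zeta> = (\<lambda>k \<omega>. y k \<omega> *\<^sub>R x k \<omega> - m)"
  \<comment> \<open>\<open>\<xi>\<close> is prescribed only on \<open>space M\<close>; the total
    version \<open>\<zeta>\<close> is an explicit function of the pair \<open>(x k, y k)\<close>,
    which yields measurability and independence.\<close>
  have \<zeta>: "\<xi> k \<omega> = \<zeta> k \<omega>" if "k \<ge> 1" "\<omega> \<in> space M" for k \<omega>
    using \<xi>[OF that] mean[OF that(1)] by (simp add: \<zeta>_def)
  have \<zeta>_meas: "random_variable borel (\<zeta> k)" if "k \<ge> 1" for k
    unfolding \<zeta>_def using meas[OF that] by measurable
  have \<zeta>_sq: "integrable M (\<lambda>\<omega>. (norm (\<zeta> k \<omega>))\<^sup>2)" if "k \<ge> 1" for k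
    using \<xi>_sq[OF that] by (subst Bochner_Integration.integrable_cong[OF refl]) (auto simp: \<zeta>[OF that])
  define w where "w = (\<lambda>e k \<omega>. \<zeta> k \<omega> \<bullet> e)"
  have w_indep: "indep_vars (\<lambda>_. borel) (w e) {1..}" for e
    using indep_vars_compose2[OF indep, of "\<lambda>k p. (snd p *\<^sub>R fst p - m) \<bullet> e" "\<lambda>_. borel"]
    by (simp add: w_def \<zeta>_def borel_measurable_continuous_onI continuous_intros)
  have w_sq: "integrable M (\<lambda>\<omega>. (w e k \<omega>)\<^sup>2)" if "k \<ge> 1" for e k
    unfolding w_def using integrable_square_inner[OF \<zeta>_meas \<zeta>_sq] that by blast
  have w_mean: "expectation (w e k) = 0" if "k \<ge> 1" for e k
    using yx[OF that] mean[OF that] by (simp add: w_def \<zeta>_def prob_space)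
  have w_var: "expectation (\<lambda>\<omega>. (w e k \<omega>)\<^sup>2) \<le> \<tau>\<^sup>2 * \<sigma> e" if k: "k \<ge> 1" for e k
  proof -
    have "second_moment M (\<xi> k) e = second_moment M (\<zeta> k) e"
      unfolding second_moment_def using k by (intro Bochner_Integration.integral_cong) (auto simp: \<zeta>)
    moreover have "0 \<le> (\<tau>\<^sup>2 *\<^sub>R S e - second_moment M (\<xi> k) e) \<bullet> e"
      using \<xi>_cov[OF k] unfolding loewner_le_def psd_op_def by blast
    ultimately show ?thesis
      using second_moment_inner[OF \<zeta>_meas[OF k] \<zeta>_sq[OF k], of e e]
      by (simp add: inner_diff_left \<sigma>_def w_def power2_eq_square)
  qed

  \<comment> \<open>The error recursion in eigencoordinates\<close>
  define z where "z = (\<lambda>e j \<omega>. (\<theta> (int j - 1) \<omega> - \<theta>star) \<bullet> e)"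
  have z_init: "z e 0 \<omega> = (\<theta>0 - \<theta>star) \<bullet> e" "z e 1 \<omega> = (\<theta>0 - \<theta>star) \<bullet> e" if "\<omega> \<in> space M" for e \<omega>
    using \<theta>_init[OF that] by (simp_all add: z_def)
  \<comment> \<open>Since \<open>S \<theta>star = m\<close>, subtracting \<open>\<theta>star\<close>
    cancels the mean of \<open>y k *\<^sub>R x k\<close> and leaves centred noise. Index
    \<open>j\<close> of \<open>z\<close> stands for time \<open>j - 1\<close>.\<close>
  have z_step: "z e (Suc (Suc j)) \<omega> =
      (1 - \<gamma> * (\<sigma> e + lam)) * (z e (Suc j) \<omega> + \<delta> * (z e (Suc j) \<omega> - z e j \<omega>))
        + \<gamma> * lam * ((\<theta>0 - \<theta>star) \<bullet> e) + \<gamma> * w e (Suc j) \<omega>"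
    if \<omega>: "\<omega> \<in> space M" and e: "e \<in> E" for e j \<omega>
  proof -
    define v where "v = \<theta> (int j) \<omega> + \<delta> *\<^sub>R (\<theta> (int j) \<omega> - \<theta> (int j - 1) \<omega>)"
    have \<theta>_eq: "\<theta> (int j + 1) \<omega> = v - \<gamma> *\<^sub>R S v - (\<gamma> * lam) *\<^sub>R v + \<gamma> *\<^sub>R (\<zeta> (Suc j) \<omega> + S \<theta>star)
        + (\<gamma> * lam) *\<^sub>R \<theta>0"
      using \<theta>_step[of "Suc j", OF _ \<omega>] by (simp add: v_def \<zeta>_def S_opt add.commute)
    have "\<theta> (int j + 1) \<omega> \<bullet> e = v \<bullet> e - \<gamma> * (\<sigma> e * (v \<bullet> e)) - \<gamma> * lam * (v \<bullet> e)
        + \<gamma> * (w e (Suc j) \<omega> + \<sigma> e * (\<theta>star \<bullet> e)) + \<gamma> * lam * (\<theta>0 \<bullet> e)"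
      unfolding \<theta>_eq
      by (simp only: inner_add_left inner_diff_left inner_scaleR_left eb.inner_apply[OF e] w_def)
    then show ?thesis
      by (simp add: z_def v_def inner_add_left inner_diff_left add.commute algebra_simps)
  qed
  define avg where "avg = (\<lambda>e \<omega>. (\<Sum>i\<le>n. z e (Suc i) \<omega>) / (real n + 1))"
  have avg: "(\<theta>bar n \<omega> - \<theta>star) \<bullet> e = avg e \<omega>" if "\<omega> \<in> space M" for e \<omega>
    using \<theta>bar[OF that, of n]
    by (simp add: avg_def z_def inner_diff_left inner_sum_left sum_subtractf atLeast0AtMost field_simps)

  \<comment> \<open>The excess risk as a sum over the eigenbasis\<close>
  define K where "K = 36 / (\<gamma> * (real n + 1)\<^sup>2) + lam"
  define P where "P = (\<lambda>r. \<Sum>e\<in>E. \<sigma> e powr r * ((\<theta>0 - \<theta>star) \<bullet> e)\<^sup>2)"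
  define T where "T = (\<lambda>b. \<Sum>e\<in>E. \<sigma> e powr b)"
  define excess where
    "excess = (\<integral>\<omega>. lsq_risk M (x 1) (y 1) (\<theta>bar n \<omega>) \<partial>M) - lsq_risk M (x 1) (y 1) \<theta>star"
  have K: "K > 0"
    unfolding K_def using \<gamma> lam by (intro add_pos_nonneg divide_pos_pos mult_pos_pos) auto

  have coord: "integrable M (\<lambda>\<omega>. (avg e \<omega>)\<^sup>2)"
    "\<sigma> e / 2 * expectation (\<lambda>\<omega>. (avg e \<omega>)\<^sup>2)
      \<le> 2 * (\<sigma> e powr r * L) * K * ((\<theta>0 - \<theta>star) \<bullet> e)\<^sup>2 + 8 * (\<tau>\<^sup>2 * (\<sigma> e powr b * L') / (real n + 1))"
    if e: "e \<in> E" and r: "r \<in> {0..1}" "neg_power lam r = ereal L"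
      and b: "b \<in> {0..1}" "neg_power lam b = ereal L'" for e r b L L'
  proof -
    note \<phi> = ratio_le_powr_times[OF pos[OF e] lam r] and \<psi> = ratio_le_powr_times[OF pos[OF e] lam b]
    have d: "(1 - sqrt (\<gamma> * lam)) / (1 + sqrt (\<gamma> * lam)) \<le> \<delta>" "\<delta> \<le> 1"
      using \<delta> by auto
    note bound = averaged_coordinate_bound[where z = "z e" and w = "w e" and n = n,
        OF \<gamma> pos[OF e] lam step_e[OF e] d \<phi> \<psi> w_indep w_sq w_mean w_var z_init z_step[OF _ e]]
    show "integrable M (\<lambda>\<omega>. (avg e \<omega>)\<^sup>2)"
      unfolding avg_def by (rule bound(1))
    show "\<sigma> e / 2 * expectation (\<lambda>\<omega>. (avg e \<omega>)\<^sup>2)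
      \<le> 2 * (\<sigma> e powr r * L) * K * ((\<theta>0 - \<theta>star) \<bullet> e)\<^sup>2 + 8 * (\<tau>\<^sup>2 * (\<sigma> e powr b * L') / (real n + 1))"
      unfolding avg_def K_def by (rule bound(2))
  qed

  have excess_eq: "excess = (\<Sum>e\<in>E. \<sigma> e / 2 * expectation (\<lambda>\<omega>. (avg e \<omega>)\<^sup>2))"
  proof -
    \<comment> \<open>Integrability lets the expected risk split over \<open>E\<close>. It is
      obtained at exponents 0, where \<open>neg_power\<close> equals one for every
      \<open>lam\<close>.\<close>
    have int: "integrable M (\<lambda>\<omega>. (avg e \<omega>)\<^sup>2)" if "e \<in> E" for e
      using coord(1)[OF that, of 0 1 0 1]
      by (cases "lam = 0") (auto simp: neg_power_def one_ereal_def lam)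
    have "lsq_risk M (x 1) (y 1) (\<theta>bar n \<omega>)
        = lsq_risk M (x 1) (y 1) \<theta>star + (\<Sum>e\<in>E. \<sigma> e / 2 * (avg e \<omega>)\<^sup>2)" if \<omega>: "\<omega> \<in> space M" for \<omega>
    proof -
      have "S (\<theta>bar n \<omega> - \<theta>star) \<bullet> (\<theta>bar n \<omega> - \<theta>star) = (\<Sum>e\<in>E. \<sigma> e * (avg e \<omega>)\<^sup>2)"
        by (subst eb.inner_expand, intro sum.cong)
           (simp_all add: eb.inner_apply avg[OF \<omega>] power2_eq_square)
      moreover have "lsq_risk M (x 1) (y 1) (\<theta>bar n \<omega>) - lsq_risk M (x 1) (y 1) \<theta>star
          = 1 / 2 * (S (\<theta>bar n \<omega> - \<theta>star) \<bullet> (\<theta>bar n \<omega> - \<theta>star))"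
        unfolding S
        by (rule excess_risk_eq[OF SM meas(2)[OF order_refl] y_sq[OF order_refl] S_opt[unfolded S m_def]])
      ultimately show ?thesis
        by (simp add: sum_divide_distrib algebra_simps)
    qed
    then have "(\<integral>\<omega>. lsq_risk M (x 1) (y 1) (\<theta>bar n \<omega>) \<partial>M)
        = (\<integral>\<omega>. lsq_risk M (x 1) (y 1) \<theta>star + (\<Sum>e\<in>E. \<sigma> e / 2 * (avg e \<omega>)\<^sup>2) \<partial>M)"
      by (intro Bochner_Integration.integral_cong) auto
    then show ?thesis
      using int by (simp add: excess_def prob_space)
  qed

  have excess_le: "excess \<le> 2 * P r * L * K + 8 * (\<tau>\<^sup>2 * T b * L' / (real n + 1))"
    if r: "r \<in> {0..1}" "neg_power lam r = ereal L"
      and b: "b \<in> {0..1}" "neg_power lam b = ereal L'" for r b L L'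
  proof -
    have "excess \<le> (\<Sum>e\<in>E. 2 * (\<sigma> e powr r * L) * K * ((\<theta>0 - \<theta>star) \<bullet> e)\<^sup>2
        + 8 * (\<tau>\<^sup>2 * (\<sigma> e powr b * L') / (real n + 1)))"
      unfolding excess_eq by (intro sum_mono coord(2)[OF _ r b])
    also have "\<dots> = 2 * P r * L * K + 8 * (\<tau>\<^sup>2 * T b * L' / (real n + 1))"
      by (simp add: P_def T_def sum.distrib sum_distrib_left sum_distrib_right sum_divide_distrib mult_ac)
    finally show ?thesis .
  qed

  \<comment> \<open>The minimum over the exponents\<close>
  define B where "B = (\<lambda>r b. 2 * ereal (P r) * neg_power lam r * ereal K
    + 8 * (ereal (\<tau>\<^sup>2 * T b) * neg_power lam b / ereal (real n + 1)))"
  have B_finite: "B r b = ereal (2 * P r * L * K + 8 * (\<tau>\<^sup>2 * T b * L' / (real n + 1)))"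
    if "neg_power lam r = ereal L" "neg_power lam b = ereal L'" for r b L L'
  proof -
    have num: "(2 :: ereal) = ereal 2" "(8 :: ereal) = ereal 8"
      by simp_all
    have "real n + 1 \<noteq> 0"
      by linarith
    then show ?thesis
      unfolding B_def that num by (simp add: ereal_divide)
  qed
  have "\<exists>r\<in>{0..1}. \<exists>b\<in>{0..1}. (\<forall>r'\<in>{0..1}. \<forall>b'\<in>{0..1}. B r b \<le> B r' b') \<and> ereal excess \<le> B r b"
  proof (cases "lam = 0")
    case True
    \<comment> \<open>At \<open>lam = 0\<close> the minimum sits at \<open>r = b = 0\<close>. As all
      eigenvalues are positive, \<open>P r\<close> or \<open>T b\<close> vanishes only if the same
      sum at exponent 0 does, so a product with \<open>\<infinity>\<close> never falls below
      it.\<close>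
    have mono: "ereal (P 0) * neg_power lam 0 \<le> ereal (P r) * neg_power lam r"
      "ereal (\<tau>\<^sup>2 * T 0) * neg_power lam 0 \<le> ereal (\<tau>\<^sup>2 * T b) * neg_power lam b" for r b
    proof -
      have "0 \<le> \<sigma> e powr r * ((\<theta>0 - \<theta>star) \<bullet> e)\<^sup>2" for e
        by simp
      then have "\<sigma> e powr r * ((\<theta>0 - \<theta>star) \<bullet> e)\<^sup>2 = 0" if "P r = 0" "e \<in> E" for e
        using that by (simp only: P_def sum_nonneg_eq_0_iff[OF eb.finite_E])
      then have "P 0 = 0" if "P r = 0"
        using that pos unfolding P_def by (intro sum.neutral) fastforce
      moreover have "0 \<le> P r"
        unfolding P_def by (intro sum_nonneg) simp
      ultimately show "ereal (P 0) * neg_power lam 0 \<le> ereal (P r) * neg_power lam r"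
        unfolding True by (intro times_neg_power_0_min[where c = P]) auto
      have "\<sigma> e powr b = 0" if "T b = 0" "e \<in> E" for e
        using that by (simp only: T_def sum_nonneg_eq_0_iff[OF eb.finite_E] powr_ge_zero)
      then have "T 0 = 0" if "T b = 0"
        using that pos unfolding T_def by (intro sum.neutral) fastforce
      moreover have "0 \<le> \<tau>\<^sup>2 * T b"
        unfolding T_def by (intro mult_nonneg_nonneg sum_nonneg) simp_all
      ultimately show "ereal (\<tau>\<^sup>2 * T 0) * neg_power lam 0 \<le> ereal (\<tau>\<^sup>2 * T b) * neg_power lam b"
        unfolding True by (intro times_neg_power_0_min[where c = "\<lambda>b. \<tau>\<^sup>2 * T b"]) auto
    qed
    have "B 0 0 \<le> B r b" for r b
      unfolding B_def
    proof (rule add_mono)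
      show "2 * ereal (P 0) * neg_power lam 0 * ereal K \<le> 2 * ereal (P r) * neg_power lam r * ereal K"
        unfolding mult.assoc[of "2 :: ereal"]
        by (intro ereal_mult_right_mono ereal_mult_left_mono mono(1)) (use K in auto)
      show "8 * (ereal (\<tau>\<^sup>2 * T 0) * neg_power lam 0 / ereal (real n + 1))
          \<le> 8 * (ereal (\<tau>\<^sup>2 * T b) * neg_power lam b / ereal (real n + 1))"
        by (intro ereal_mult_left_mono ereal_divide_right_mono mono(2)) auto
    qed
    moreover have neg: "neg_power lam 0 = ereal 1"
      by (simp add: True neg_power_def)
    have "ereal excess \<le> B 0 0"
      unfolding B_finite[OF neg neg] using excess_le[OF _ neg _ neg] by simp
    ultimately show ?thesis
      by (intro bexI[of _ 0] conjI ballI) auto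
  next
    case False
    then have neg: "neg_power lam r = ereal (lam powr - r)" for r
      by (simp add: neg_power_def)
    \<comment> \<open>The two summands of \<open>B\<close> depend on \<open>r\<close> and on
      \<open>b\<close> separately, so each is minimized on its own; positive bases make the powers
      continuous on the compact interval.\<close>
    have "continuous_on {0..1} (\<lambda>r. 2 * P r * lam powr - r * K)"
      unfolding P_def using pos False by (intro continuous_intros) (auto dest: pos)
    then obtain r where r: "r \<in> {0..1}"
      "\<And>r'. r' \<in> {0..1} \<Longrightarrow> 2 * P r * lam powr - r * K \<le> 2 * P r' * lam powr - r' * K"
      using continuous_attains_inf[of "{0..1::real}" "\<lambda>r. 2 * P r * lam powr - r * K"] by auto
    have "continuous_on {0..1} (\<lambda>b. 8 * (\<tau>\<^sup>2 * T b * lam powr - b / (real n + 1)))"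
      unfolding T_def using pos False by (intro continuous_intros) (auto dest: pos)
    then obtain b where b: "b \<in> {0..1}"
      "\<And>b'. b' \<in> {0..1} \<Longrightarrow> 8 * (\<tau>\<^sup>2 * T b * lam powr - b / (real n + 1))
        \<le> 8 * (\<tau>\<^sup>2 * T b' * lam powr - b' / (real n + 1))"
      using continuous_attains_inf[of "{0..1::real}" "\<lambda>b. 8 * (\<tau>\<^sup>2 * T b * lam powr - b / (real n + 1))"]
      by auto
    have "B r b \<le> B r' b'" if "r' \<in> {0..1}" "b' \<in> {0..1}" for r' b'
      unfolding B_finite[OF neg neg] using r(2)[OF that(1)] b(2)[OF that(2)] by simp
    moreover have "ereal excess \<le> B r b"
      unfolding B_finite[OF neg neg] using excess_le[OF r(1) neg b(1) neg] by simp
    ultimately show ?thesis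
      using r(1) b(1) by blast
  qed
  then show ?thesis
    unfolding Let_def B_def excess_def K_def P_def T_def eb.norm_op_powr eb.trace_op_powr .
qed

end
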